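(* Let $(H,U,J,\gamma_*,\beta,\zeta)$ be real parameter values with $W_J=0$, and let $(E,\kappa,\omega,\zeta)$ be the associated linear parameters $$E=\tfrac14\Big(H+\beta J+\tfrac{UJ}{2}\Big),\qquad \kappa=\tfrac J4,\qquad \omega=\beta U+\tfrac{U^2}{4}-\gamma_* .$$ Assume that $(E,\kappa,\omega,\zeta)\in\Omega$, that $F(x)$ is linearly independent from $1,x,\frac1x$, that the amplitude profile $A(y)$ is non-constant, that $\sigma\neq0$ and $D\neq0$, and that $T_*=4\pi W_H\neq0$. Then Whitham modulation theory predicts the same criterion for modulational instability as the linear theory: the quasi-linear Whitham system $A\,v_T+a\,v_X=0$ (in case (i) $W_{HJ}\neq0$ or case (ii) $W_{JJ}\neq0$, $W_{HH}\neq 0$) has a complex (non-real) characteristic, i.e. $A^{-1}a$ has an eigenvalue $X'/T'\in\mathbb C\setminus\mathbb R$, if and only if, for real Floquet exponent $\mu\neq0$, the normal form $$\det\left(\lambda^{2}\begin{pmatrix}a_2 & b_2 \\ b_2 & d_2\end{pmatrix}+\lambda\mu\begin{pmatrix}a_1 & b_1 \\ b_1 & d_1\end{pmatrix}+\mu^{2}\begin{pmatrix}a_0 & b_0 \\ b_0 & d_0\end{pmatrix}\right)=0$$ has a root $\lambda$ with $\mathrm{Re}(\lambda)\neq0$; the correspondence between characteristics and roots is $\frac{X'}{T'}=\frac{i\lambda}{\mu}+U$. In this case the underlying wave is modulationally unstable.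
   Context: **Equation and linear-theory quantities.** Consider $i\psi_t=\psi_{xx}+\zeta f(|\psi|^2)\psi$, with $f$ real-valued and well-behaved (regular enough that all parameter derivatives below exist and mixed partial derivatives are symmetric), and $F$ a fixed antiderivative of $f$ ($F'=f$). Travelling waves are reduced, using phase, translation and Galilean invariance, to $\psi=e^{i\omega t}e^{iS(y)}A(y)$ with $S_y=\kappa/A^2$ and $$A_y^2=2E-\omega A^2-\frac{\kappa^2}{A^2}-\zeta F(A^2).$$ $\Omega$ is the open set of $(E,\kappa,\omega,\zeta)$ such that $\kappa>0$ and the function $2E-\omega A^2-\kappa^2/A^2-\zeta F(A^2)$ has two positive real simple roots $a_-<a_+$ and is real and positive for $A\in(a_-,a_+)$. The profile $A(y)$ is the periodic solution with $A(0)=a_-$, $A(T_*/2)=a_+$. On $\Omega$ one can freely differentiate in the parameters. Put $$K(E,\kappa,\omega,\zeta)=2\int_{a_-}^{a_+}\sqrt{2E-\omega A^2-\tfrac{\kappa^2}{A^2}-\zeta F(A^2)}\,dA,$$ $T_*=K_E$ (period), $\eta=-K_\kappa$ (quasi-momentum), $M=-2K_\omega$ (mass). Subscripts $E,\kappa,\omega,\zeta$ on $K,T_*,\eta,M$ are partial derivatives in these independent variables (e.g. $T_{*\kappa}=\partial_\kappa T_*$). Write $\{P,Q\}_{x,y}=P_xQ_y-P_yQ_x$. Define $$\sigma=\{T_*,\eta\}_{E,\kappa},\quad \gamma=\{T_*,\eta\}_{\kappa,\omega},\quad \rho=\{T_*,\eta\}_{\omega,E},\quad \tau=\tfrac{T_*T_{*\kappa}}2,\quad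 \nu=-\tfrac{T_*T_{*E}}2,\quad \xi=\{T_*,\eta\}_{\kappa,\zeta},$$ $$D=\begin{vmatrix}K_{\kappa\kappa} & K_{\kappa E} & K_{\kappa\omega} & T_* \\ K_{\kappa E} & K_{EE} & K_{E\omega} & 0 \\ K_{\kappa\omega} & K_{E\omega} & K_{\omega\omega} & 0 \\ T_* & 0 & 0 & -M\end{vmatrix}.$$ The matrix entries of the normal form are $$a_2=-\tfrac\sigma2(\gamma M_E+\rho M_\kappa+\sigma M_\omega),\quad b_2=-\tfrac{\sigma\rho T_*}{2},\quad d_2=-\tfrac\sigma2\big(\nu T_*+\tfrac\sigma2M\big),$$ $$a_1=2i\sigma\rho T_*,\quad b_1=i\sigma T_*(\nu+\gamma),\quad d_1=i\sigma T_*(2\tau+\sigma\kappa),$$ $$a_0=2\sigma\nu T_*,\quad b_0=2\sigma\tau T_*,\quad d_0=2\sigma T_*(\omega\gamma+\zeta\xi-E\sigma).$$ **Linear operator and modulational instability.** Perturbing the wave as $\psi=e^{i\omega t}e^{iS(y)}(A(y)+\epsilon(u+iv))$ gives, at first order in $\epsilon$, $(u,v)^\top_t=\mathcal L(u,v)^\top$ with $$\mathcal L=\begin{pmatrix}\mathcal K & -\mathcal L_- \\ \mathcal L_+ & \mathcal K\end{pmatrix},\quad \mathcal K=S_{yy}+2S_y\partial_y,\quad \mathcal L_-=-\omega-\partial_{yy}+S_y^2-\zeta f(A^2),\quad \mathcal L_+=\mathcal L_--2\zeta f'(A^2)A^2 .$$ The spectrum of $\mathcal L$ on $L^2(\mathbb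 R)$ is the union over $\mu\in(-\pi/T_*,\pi/T_*]$ of the spectra of $\mathcal L$ with boundary conditions $\mathbf u(T_* )=e^{i\mu T_*}\mathbf u(0)$, $\mathbf u_y(T_* )=e^{i\mu T_*}\mathbf u_y(0)$; $\mu$ is the Floquet exponent. Modulational instability means spectral instability to long-wavelength perturbations: $\mathcal L$ has spectrum off the imaginary axis in every neighbourhood of the origin. The linear theory (a result of Leisman, Bronski, Johnson and Marangell, taken as known) says that when $\sigma\ne0$, $D\neq0$ the four continuous bands of spectrum emerging from the origin, for small $\mu$, are given by the displayed quartic determinant plus terms $\lambda^i\mu^j$ of total order at least $5$, set equal to zero; the linear criterion for modulational instability is that some root $\lambda$ of the normal form is not purely imaginary. **Whitham equations.** The slowly varying parameters (functions of slow variables $X=\epsilon x$, $T=\epsilon t$) are $H,\omega_*,k,B,\gamma_*,\beta$, and one sets $U=\omega_*/k$, $J=B/k$. Define $$W(H,U,J,\gamma_*,\beta,\zeta)=\frac{\sqrt2}{\pi}\int_{R_-}^{R_+}\sqrt{H+\beta J+\tfrac{UJ}2-2R^2\big(\beta U+\tfrac{U^2}4-\gamma_*\big)-\tfrac{J^2}{8R^2}-2\zeta F(R^2)}\;dR,$$ where $R_\pm=a_\pm$ are the corresponding simple roots of the expression under the square root. One has $K=\pi W$ under $E=\frac14(H+\beta J+\frac{UJ}2)$, $\kappa=\frac J4$, $\omega=\beta U+\frac{U^2}4-\gamma_*$. Subscripts on $W$ denote partial derivatives with respect to the independent arguments $H,U,J,\gamma_*,\beta,\zeta$; $M_*:=W_{\gamma_*}$.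 The averaged Lagrangian is $\mathscr L=2kW-H$. The Whitham equations are $\partial_T\mathscr L_{\omega_*}-\partial_X\mathscr L_k=0$, $\partial_T\mathscr L_{\gamma_*}-\partial_X\mathscr L_\beta=0$, $\partial_Tk+\partial_X\omega_*=0$, $\partial_T\beta+\partial_X\gamma_*=0$ (derivatives of $\mathscr L$ taken with $H,\omega_*,k,B,\gamma_*,\beta$ independent), together with $\mathscr L_H=0$ and $\mathscr L_B=0$, i.e. $W_H=\frac1{2k}$ and $W_J=0$. Eliminating $k$ and using $W_J=0$, they become $$\beta_T+\gamma_{*X}=0,\qquad(1)$$ $$\partial_TW_H+U\partial_XW_H-W_HU_X=0,\qquad(2)$$ $$\partial_TW_U+U\partial_XW_U+W_UU_X-\partial_XW=0,\qquad(3)$$ $$W_H\partial_TM_*-M_*\partial_TW_H+UW_H\partial_XM_*-UM_*\partial_XW_H+W_HM_*U_X-W_H^2J_X=0.\qquad(4)$$ Since $\sigma=256\pi^2(W_{HJ}^2-W_{HH}W_{JJ})\ne0$, at least one of the following cases holds. The relation $W_J=0$ is solved by the implicit function theorem: (i) if $W_{HJ}\neq0$, as $H=g(U,J,\gamma_*,\beta)$; substituting this into (1)–(4), expanding all $X,T$-derivatives by the chain rule, and multiplying (2)–(4) by $W_{HJ}$ gives the quasi-linear system $A\,v_T+a\,v_X=0$ with $v=(J,\gamma_*,U,\beta)^{\top}$; (ii) if $W_{JJ}\neq0$ and $W_{HH}\ne 0$, as $J=h(H,U,\gamma_*,\beta)$; the same procedure, multiplying (2)–(4) by $W_{JJ}$,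 gives $A\,v_T+a\,v_X=0$ with $v=(H,\gamma_*,U,\beta)^{\top}$. In each case the rows of the $4\times4$ matrices $A,a$ correspond to (1),(2),(3),(4) in this order, and $A,a$ are evaluated at the given parameter point (where $W_J=0$). Characteristics $X'/T'$ are the eigenvalues of $A^{-1}a$, equivalently $\det(AX'-aT')=0$, $T'\ne0$ ($A$ is invertible under the stated hypotheses). *)

theory Defs
  imports "HOL-Analysis.Analysis"
begin

definition partial :: "'n::finite \<Rightarrow> (real^'n \<Rightarrow> real) \<Rightarrow> real^'n \<Rightarrow> real" where
  "partial i \<Phi> x = deriv (\<lambda>t. \<Phi> (x + t *\<^sub>R axis i 1)) 0"

definition C1_on :: "(real^'n::finite) set \<Rightarrow> (real^'n \<Rightarrow> real) \<Rightarrow> bool" where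
  "C1_on S \<Phi> \<longleftrightarrow>
     (\<exists>\<Phi>' :: real^'n \<Rightarrow> (real^'n) \<Rightarrow>\<^sub>L real.
        (\<forall>x\<in>S. (\<Phi> has_derivative blinfun_apply (\<Phi>' x)) (at x)) \<and> continuous_on S \<Phi>')"

definition C2_on :: "(real^'n::finite) set \<Rightarrow> (real^'n \<Rightarrow> real) \<Rightarrow> bool" where
  "C2_on S \<Phi> \<longleftrightarrow> C1_on S \<Phi> \<and> (\<forall>i. C1_on S (partial i \<Phi>)) \<and>
     (\<forall>x\<in>S. \<forall>i j. partial i (partial j \<Phi>) x = partial j (partial i \<Phi>) x)"

definition jac :: "(real^'n::finite \<Rightarrow> real) \<Rightarrow> (real^'n \<Rightarrow> real) \<Rightarrow> 'n \<Rightarrow> 'n \<Rightarrow> real^'n \<Rightarrow> real" where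
  "jac P Q i j x = partial i P x * partial j Q x - partial j P x * partial i Q x"

datatype wave_index = iE | i\<kappa> | i\<omega> | i\<zeta>

instance wave_index :: finite
proof
  have "UNIV = {iE, i\<kappa>, i\<omega>, i\<zeta>}"
    using wave_index.exhaust by auto
  then show "finite (UNIV :: wave_index set)"
    by (metis finite.emptyI finite_insert)
qed

type_synonym wave_par = "real^wave_index"

definition profile_rhs :: "(real \<Rightarrow> real) \<Rightarrow> wave_par \<Rightarrow> real \<Rightarrow> real" where
  "profile_rhs F p x = 2 * p$iE - p$i\<omega> * x\<^sup>2 - (p$i\<kappa>)\<^sup>2 / x\<^sup>2 - p$i\<zeta> * F (x\<^sup>2)"

definition simple_root :: "(real \<Rightarrow> real) \<Rightarrow> real \<Rightarrow> bool" where
  "simple_root G x \<longleftrightarrow> G x = 0 \<and> deriv G x \<noteq> 0"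

definition admissible_roots :: "(real \<Rightarrow> real) \<Rightarrow> wave_par \<Rightarrow> real \<Rightarrow> real \<Rightarrow> bool" where
  "admissible_roots F p a b \<longleftrightarrow> 0 < a \<and> a < b \<and>
     simple_root (profile_rhs F p) a \<and> simple_root (profile_rhs F p) b \<and>
     (\<forall>x\<in>{a<..<b}. profile_rhs F p x > 0)"

definition Omega :: "(real \<Rightarrow> real) \<Rightarrow> wave_par set" where
  "Omega F = {p. p$i\<kappa> > 0 \<and> (\<exists>a b. admissible_roots F p a b)}"

text \<open>
  For a general nonlinearity the profile equation may have several admissible pairs of roots at
  the same parameters. The roots \<open>a\<^sub>-\<close>, \<open>a\<^sub>+\<close> are therefore functions \<open>am\<close>, \<open>ap\<close> that select such a
  pair continuously on an open set \<open>N\<close> of parameters, on which one may differentiate.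
\<close>

definition root_branch ::
  "(real \<Rightarrow> real) \<Rightarrow> wave_par set \<Rightarrow> (wave_par \<Rightarrow> real) \<Rightarrow> (wave_par \<Rightarrow> real) \<Rightarrow> bool" where
  "root_branch F N am ap \<longleftrightarrow> open N \<and> N \<subseteq> Omega F \<and> continuous_on N am \<and> continuous_on N ap \<and>
     (\<forall>p\<in>N. admissible_roots F p (am p) (ap p))"

definition action ::
  "(real \<Rightarrow> real) \<Rightarrow> (wave_par \<Rightarrow> real) \<Rightarrow> (wave_par \<Rightarrow> real) \<Rightarrow> wave_par \<Rightarrow> real" where
  "action F am ap p = 2 * integral {am p..ap p} (\<lambda>x. sqrt (profile_rhs F p x))"

text \<open>
  Regularity of the nonlinearity: \<open>f'\<close> enters the linearised operator, and the action has
  continuous second derivatives with symmetric mixed partials.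
\<close>

definition well_behaved ::
  "(real \<Rightarrow> real) \<Rightarrow> (real \<Rightarrow> real) \<Rightarrow> wave_par set \<Rightarrow> (wave_par \<Rightarrow> real) \<Rightarrow> (wave_par \<Rightarrow> real) \<Rightarrow> bool" where
  "well_behaved f F N am ap \<longleftrightarrow>
     (\<forall>x>0. (F has_real_derivative f x) (at x)) \<and>
     (\<forall>x>0. f differentiable (at x)) \<and> continuous_on {0<..} (deriv f) \<and>
     C2_on N (action F am ap)"

definition indep_one_id_inverse :: "(real \<Rightarrow> real) \<Rightarrow> bool" where
  "indep_one_id_inverse F \<longleftrightarrow>
     (\<forall>c0 c1 c2 c3. (\<forall>x>0. c0 + c1 * x + c2 / x + c3 * F x = 0) \<longrightarrow>
        c0 = 0 \<and> c1 = 0 \<and> c2 = 0 \<and> c3 = 0)"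

definition period :: "(wave_par \<Rightarrow> real) \<Rightarrow> wave_par \<Rightarrow> real" where
  "period K = partial iE K"

definition quasimomentum :: "(wave_par \<Rightarrow> real) \<Rightarrow> wave_par \<Rightarrow> real" where
  "quasimomentum K p = - partial i\<kappa> K p"

definition mass :: "(wave_par \<Rightarrow> real) \<Rightarrow> wave_par \<Rightarrow> real" where
  "mass K p = - 2 * partial i\<omega> K p"

definition wave_profile ::
  "(real \<Rightarrow> real) \<Rightarrow> wave_par \<Rightarrow> real \<Rightarrow> real \<Rightarrow> real \<Rightarrow> (real \<Rightarrow> real) \<Rightarrow> bool" where
  "wave_profile F p a b T A \<longleftrightarrow>
     (\<forall>y. A differentiable (at y)) \<and> (\<forall>y. (deriv A y)\<^sup>2 = profile_rhs F p (A y)) \<and>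
     A 0 = a \<and> A (T / 2) = b \<and> (\<forall>y. A (y + T) = A y)"

definition nf_sigma :: "(wave_par \<Rightarrow> real) \<Rightarrow> wave_par \<Rightarrow> real" where
  "nf_sigma K = jac (period K) (quasimomentum K) iE i\<kappa>"

definition nf_gamma :: "(wave_par \<Rightarrow> real) \<Rightarrow> wave_par \<Rightarrow> real" where
  "nf_gamma K = jac (period K) (quasimomentum K) i\<kappa> i\<omega>"

definition nf_rho :: "(wave_par \<Rightarrow> real) \<Rightarrow> wave_par \<Rightarrow> real" where
  "nf_rho K = jac (period K) (quasimomentum K) i\<omega> iE"

definition nf_xi :: "(wave_par \<Rightarrow> real) \<Rightarrow> wave_par \<Rightarrow> real" where
  "nf_xi K = jac (period K) (quasimomentum K) i\<kappa> i\<zeta>"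

definition nf_tau :: "(wave_par \<Rightarrow> real) \<Rightarrow> wave_par \<Rightarrow> real" where
  "nf_tau K p = period K p * partial i\<kappa> (period K) p / 2"

definition nf_nu :: "(wave_par \<Rightarrow> real) \<Rightarrow> wave_par \<Rightarrow> real" where
  "nf_nu K p = - (period K p * partial iE (period K) p / 2)"

definition nf_D :: "(wave_par \<Rightarrow> real) \<Rightarrow> wave_par \<Rightarrow> real" where
  "nf_D K p =
    (let K2 = (\<lambda>i j. partial i (partial j K) p); T = period K p; M = mass K p in
     det (vector
       [vector [K2 i\<kappa> i\<kappa>, K2 i\<kappa> iE, K2 i\<kappa> i\<omega>, T],
        vector [K2 i\<kappa> iE, K2 iE iE, K2 iE i\<omega>, 0],
        vector [K2 i\<kappa> i\<omega>, K2 iE i\<omega>, K2 i\<omega> i\<omega>, 0],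
        vector [T, 0, 0, - M]] :: real^4^4))"

definition normal_form :: "(wave_par \<Rightarrow> real) \<Rightarrow> wave_par \<Rightarrow> complex \<Rightarrow> real \<Rightarrow> complex" where
  "normal_form K p lam \<mu> =
    (let E = p$iE; \<kappa> = p$i\<kappa>; \<omega> = p$i\<omega>; \<zeta> = p$i\<zeta>;
         T = period K p; M = mass K p; M\<^sub>E = partial iE (mass K) p;
         M\<^sub>\<kappa> = partial i\<kappa> (mass K) p; M\<^sub>\<omega> = partial i\<omega> (mass K) p;
         \<sigma> = nf_sigma K p; \<gamma> = nf_gamma K p; \<rho> = nf_rho K p;
         \<tau> = nf_tau K p; \<nu> = nf_nu K p; \<xi> = nf_xi K p;
         a2 = complex_of_real (- \<sigma> / 2 * (\<gamma> * M\<^sub>E + \<rho> * M\<^sub>\<kappa> + \<sigma> * M\<^sub>\<omega>));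
         b2 = complex_of_real (- (\<sigma> * \<rho> * T) / 2);
         d2 = complex_of_real (- \<sigma> / 2 * (\<nu> * T + \<sigma> / 2 * M));
         a1 = \<i> * complex_of_real (2 * \<sigma> * \<rho> * T);
         b1 = \<i> * complex_of_real (\<sigma> * T * (\<nu> + \<gamma>));
         d1 = \<i> * complex_of_real (\<sigma> * T * (2 * \<tau> + \<sigma> * \<kappa>));
         a0 = complex_of_real (2 * \<sigma> * \<nu> * T);
         b0 = complex_of_real (2 * \<sigma> * \<tau> * T);
         d0 = complex_of_real (2 * \<sigma> * T * (\<omega> * \<gamma> + \<zeta> * \<xi> - E * \<sigma>));
         m = complex_of_real \<mu>;
         M2 = (vector [vector [a2, b2], vector [b2, d2]] :: complex^2^2);
         M1 = (vector [vector [a1, b1], vector [b1, d1]] :: complex^2^2);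
         M0 = (vector [vector [a0, b0], vector [b0, d0]] :: complex^2^2)
     in det (\<chi> r c. lam\<^sup>2 * M2$r$c + lam * m * M1$r$c + m\<^sup>2 * M0$r$c))"

text \<open>
  The perturbation \<open>(u, v)\<close> is a function \<open>w\<close> with values in \<open>complex^2\<close>. The operator is written
  pointwise, in terms of the values \<open>w0\<close>, \<open>w1\<close>, \<open>w2\<close> of \<open>w\<close> and its first two derivatives at \<open>y\<close>,
  because the second derivative of a function of class \<open>H\<^sup>2\<close> is only defined almost everywhere.
\<close>

definition lin_op ::
  "(real \<Rightarrow> real) \<Rightarrow> wave_par \<Rightarrow> (real \<Rightarrow> real) \<Rightarrow> real \<Rightarrow> complex^2 \<Rightarrow> complex^2 \<Rightarrow> complex^2 \<Rightarrow> complex^2" where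
  "lin_op f p A y w0 w1 w2 =
    (let \<omega> = p$i\<omega>; \<zeta> = p$i\<zeta>;
         Sy = (\<lambda>z. p$i\<kappa> / (A z)\<^sup>2);
         LK = (\<lambda>h0 h1. complex_of_real (deriv Sy y) * h0 + 2 * complex_of_real (Sy y) * h1);
         Lminus = (\<lambda>h0 h2. complex_of_real (- \<omega> + (Sy y)\<^sup>2 - \<zeta> * f ((A y)\<^sup>2)) * h0 - h2);
         Lplus = (\<lambda>h0 h2. Lminus h0 h2 - complex_of_real (2 * \<zeta> * deriv f ((A y)\<^sup>2) * (A y)\<^sup>2) * h0)
     in vector [LK (w0$1) (w1$1) - Lminus (w0$2) (w2$2),
                Lplus (w0$1) (w2$1) + LK (w0$2) (w1$2)])"

definition L2_on :: "real \<Rightarrow> (real \<Rightarrow> complex^2) \<Rightarrow> bool" where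
  "L2_on T h \<longleftrightarrow> h \<in> borel_measurable (lebesgue_on {0..T}) \<and>
     integrable (lebesgue_on {0..T}) (\<lambda>y. (norm (h y))\<^sup>2)"

definition L2_norm_sq :: "real \<Rightarrow> (real \<Rightarrow> complex^2) \<Rightarrow> real" where
  "L2_norm_sq T h = integral\<^sup>L (lebesgue_on {0..T}) (\<lambda>y. (norm (h y))\<^sup>2)"

text \<open>\<open>w \<in> H\<^sup>2(0,T)\<close> with derivatives \<open>w1\<close>, \<open>w2\<close> and the quasi-periodic boundary conditions.\<close>

definition floquet_domain ::
  "real \<Rightarrow> real \<Rightarrow> (real \<Rightarrow> complex^2) \<Rightarrow> (real \<Rightarrow> complex^2) \<Rightarrow> (real \<Rightarrow> complex^2) \<Rightarrow> bool" where
  "floquet_domain T \<mu> w w1 w2 \<longleftrightarrow>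
     (\<forall>y\<in>{0..T}. (w has_vector_derivative w1 y) (at y within {0..T})) \<and>
     (\<forall>y\<in>{0..T}. (w2 has_integral (w1 y - w1 0)) {0..y}) \<and> L2_on T w2 \<and>
     w T = exp (\<i> * complex_of_real (\<mu> * T)) *s w 0 \<and>
     w1 T = exp (\<i> * complex_of_real (\<mu> * T)) *s w1 0"

text \<open>
  \<open>lam\<close> is in the resolvent set when \<open>L - lam\<close>, with these boundary conditions, is a bijection from
  its domain onto \<open>L\<^sup>2(0,T)\<close> with bounded inverse.
\<close>

definition floquet_resolvent_set ::
  "(real \<Rightarrow> real) \<Rightarrow> wave_par \<Rightarrow> (real \<Rightarrow> real) \<Rightarrow> real \<Rightarrow> real \<Rightarrow> complex set" where
  "floquet_resolvent_set f p A T \<mu> = {lam.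
     let solves = (\<lambda>h w w1 w2. floquet_domain T \<mu> w w1 w2 \<and>
           (AE y in lebesgue_on {0..T}. lin_op f p A y (w y) (w1 y) (w2 y) - lam *s w y = h y))
     in \<exists>C. \<forall>h. L2_on T h \<longrightarrow>
          (\<exists>w w1 w2. solves h w w1 w2 \<and> L2_norm_sq T w \<le> C * L2_norm_sq T h \<and>
             (\<forall>z z1 z2. solves h z z1 z2 \<longrightarrow> (\<forall>y\<in>{0..T}. z y = w y)))}"

definition floquet_spectrum ::
  "(real \<Rightarrow> real) \<Rightarrow> wave_par \<Rightarrow> (real \<Rightarrow> real) \<Rightarrow> real \<Rightarrow> real \<Rightarrow> complex set" where
  "floquet_spectrum f p A T \<mu> = - floquet_resolvent_set f p A T \<mu>"

text \<open>The spectrum on \<open>L\<^sup>2(\<real>)\<close>, through its Floquet--Bloch decomposition.\<close>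

definition lin_spectrum ::
  "(real \<Rightarrow> real) \<Rightarrow> wave_par \<Rightarrow> (real \<Rightarrow> real) \<Rightarrow> real \<Rightarrow> complex set" where
  "lin_spectrum f p A T = (\<Union>\<mu>\<in>{- pi / T<..pi / T}. floquet_spectrum f p A T \<mu>)"

definition modulationally_unstable ::
  "(real \<Rightarrow> real) \<Rightarrow> wave_par \<Rightarrow> (real \<Rightarrow> real) \<Rightarrow> real \<Rightarrow> bool" where
  "modulationally_unstable f p A T \<longleftrightarrow>
     (\<forall>\<epsilon>>0. \<exists>lam\<in>lin_spectrum f p A T. cmod lam < \<epsilon> \<and> Re lam \<noteq> 0)"

text \<open>
  The result of Leisman, Bronski, Johnson and Marangell: near the origin, for small Floquet
  exponent, the spectrum is the zero set of the normal form plus a convergent power series in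
  \<open>lam\<close>, \<open>\<mu>\<close> whose terms all have total order at least five.
\<close>

definition linear_theory ::
  "(real \<Rightarrow> real) \<Rightarrow> (wave_par \<Rightarrow> real) \<Rightarrow> wave_par \<Rightarrow> (real \<Rightarrow> real) \<Rightarrow> bool" where
  "linear_theory f K p A \<longleftrightarrow>
     (\<exists>(c :: nat \<times> nat \<Rightarrow> complex) r. r > 0 \<and>
        (\<forall>lam \<mu>. cmod lam < r \<and> \<bar>\<mu>\<bar> < r \<longrightarrow>
           (let term_at = (\<lambda>(i, j). c (i, j) * lam ^ i * complex_of_real \<mu> ^ j) in
            term_at summable_on {(i, j). 5 \<le> i + j} \<and>
            (lam \<in> floquet_spectrum f p A (period K p) \<mu> \<longleftrightarrow>
               normal_form K p lam \<mu> + infsum term_at {(i, j). 5 \<le> i + j} = 0))))"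

datatype whitham_index = jH | jU | jJ | j\<gamma> | j\<beta> | j\<zeta>

instance whitham_index :: finite
proof
  have "UNIV = {jH, jU, jJ, j\<gamma>, j\<beta>, j\<zeta>}"
    using whitham_index.exhaust by auto
  then show "finite (UNIV :: whitham_index set)"
    by (metis finite.emptyI finite_insert)
qed

type_synonym whitham_par = "real^whitham_index"

definition whitham_point :: "real \<Rightarrow> real \<Rightarrow> real \<Rightarrow> real \<Rightarrow> real \<Rightarrow> real \<Rightarrow> whitham_par" where
  "whitham_point H U J \<gamma> \<beta> \<zeta> =
     (\<chi> i. case i of jH \<Rightarrow> H | jU \<Rightarrow> U | jJ \<Rightarrow> J | j\<gamma> \<Rightarrow> \<gamma> | j\<beta> \<Rightarrow> \<beta> | j\<zeta> \<Rightarrow> \<zeta>)"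

definition linear_par :: "whitham_par \<Rightarrow> wave_par" where
  "linear_par q = (\<chi> i. case i of
       iE \<Rightarrow> (q$jH + q$j\<beta> * q$jJ + q$jU * q$jJ / 2) / 4
     | i\<kappa> \<Rightarrow> q$jJ / 4
     | i\<omega> \<Rightarrow> q$j\<beta> * q$jU + (q$jU)\<^sup>2 / 4 - q$j\<gamma>
     | i\<zeta> \<Rightarrow> q$j\<zeta>)"

definition whitham_W ::
  "(real \<Rightarrow> real) \<Rightarrow> (wave_par \<Rightarrow> real) \<Rightarrow> (wave_par \<Rightarrow> real) \<Rightarrow> whitham_par \<Rightarrow> real" where
  "whitham_W F am ap q = sqrt 2 / pi *
     integral {am (linear_par q)..ap (linear_par q)}
       (\<lambda>R. sqrt (q$jH + q$j\<beta> * q$jJ + q$jU * q$jJ / 2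
          - 2 * R\<^sup>2 * (q$j\<beta> * q$jU + (q$jU)\<^sup>2 / 4 - q$j\<gamma>)
          - (q$jJ)\<^sup>2 / (8 * R\<^sup>2) - 2 * q$j\<zeta> * F (R\<^sup>2)))"

text \<open>
  Let \<open>\<Theta> v\<close> be the full parameter vector with the solution of \<open>W\<^sub>J = 0\<close> substituted, as a function
  of the remaining unknowns \<open>v\<close>. By the chain rule, \<open>\<partial>\<^sub>T (\<Phi> (\<Theta> v))\<close> is \<open>whitham_grad \<Theta> v \<Phi>\<close> applied
  to \<open>v\<^sub>T\<close>, and similarly for \<open>X\<close>; the rows of the matrices \<open>A\<close>, \<open>a\<close> are the resulting coefficients
  of \<open>v\<^sub>T\<close>, \<open>v\<^sub>X\<close> in
    \<open>\<beta>\<^sub>T + \<gamma>\<^sub>X = 0\<close>,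
    \<open>\<partial>\<^sub>T W\<^sub>H + U \<partial>\<^sub>X W\<^sub>H - W\<^sub>H U\<^sub>X = 0\<close>,
    \<open>\<partial>\<^sub>T W\<^sub>U + U \<partial>\<^sub>X W\<^sub>U + W\<^sub>U U\<^sub>X - \<partial>\<^sub>X W = 0\<close>,
    \<open>W\<^sub>H \<partial>\<^sub>T M - M \<partial>\<^sub>T W\<^sub>H + U W\<^sub>H \<partial>\<^sub>X M - U M \<partial>\<^sub>X W\<^sub>H + W\<^sub>H M U\<^sub>X - W\<^sub>H\<^sup>2 J\<^sub>X = 0\<close>,
  with \<open>M = W\<^sub>\<gamma>\<close>, where the last three equations are multiplied by \<open>m\<close>.
\<close>

definition whitham_grad :: "(real^4 \<Rightarrow> whitham_par) \<Rightarrow> real^4 \<Rightarrow> (whitham_par \<Rightarrow> real) \<Rightarrow> real^4" where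
  "whitham_grad \<Theta> v \<Phi> = (\<chi> i. partial i (\<lambda>v. \<Phi> (\<Theta> v)) v)"

definition whitham_A :: "(whitham_par \<Rightarrow> real) \<Rightarrow> (real^4 \<Rightarrow> whitham_par) \<Rightarrow> real^4 \<Rightarrow> real \<Rightarrow> real^4^4" where
  "whitham_A W \<Theta> v m =
    (let d = whitham_grad \<Theta> v; W\<^sub>H = partial jH W; W\<^sub>U = partial jU W; M = partial j\<gamma> W; q = \<Theta> v in
     vector
      [d (\<lambda>q. q$j\<beta>),
       m *\<^sub>R d W\<^sub>H,
       m *\<^sub>R d W\<^sub>U,
       m *\<^sub>R (W\<^sub>H q *\<^sub>R d M - M q *\<^sub>R d W\<^sub>H)])"

definition whitham_a :: "(whitham_par \<Rightarrow> real) \<Rightarrow> (real^4 \<Rightarrow> whitham_par) \<Rightarrow> real^4 \<Rightarrow> real \<Rightarrow> real^4^4" where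
  "whitham_a W \<Theta> v m =
    (let d = whitham_grad \<Theta> v; W\<^sub>H = partial jH W; W\<^sub>U = partial jU W; M = partial j\<gamma> W; q = \<Theta> v;
         U = q$jU; dU = d (\<lambda>q. q$jU); dJ = d (\<lambda>q. q$jJ) in
     vector
      [d (\<lambda>q. q$j\<gamma>),
       m *\<^sub>R (U *\<^sub>R d W\<^sub>H - W\<^sub>H q *\<^sub>R dU),
       m *\<^sub>R (U *\<^sub>R d W\<^sub>U + W\<^sub>U q *\<^sub>R dU - d W),
       m *\<^sub>R ((U * W\<^sub>H q) *\<^sub>R d M - (U * M q) *\<^sub>R d W\<^sub>H + (W\<^sub>H q * M q) *\<^sub>R dU - (W\<^sub>H q)\<^sup>2 *\<^sub>R dJ)])"

text \<open>Case (i): \<open>v = (J, \<gamma>, U, \<beta>)\<close> and \<open>H = g v\<close>. Case (ii): \<open>v = (H, \<gamma>, U, \<beta>)\<close> and \<open>J = h v\<close>.\<close>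

definition subst_H :: "real \<Rightarrow> (real^4 \<Rightarrow> real) \<Rightarrow> real^4 \<Rightarrow> whitham_par" where
  "subst_H \<zeta> g v = whitham_point (g v) (v$3) (v$1) (v$2) (v$4) \<zeta>"

definition subst_J :: "real \<Rightarrow> (real^4 \<Rightarrow> real) \<Rightarrow> real^4 \<Rightarrow> whitham_par" where
  "subst_J \<zeta> h v = whitham_point (v$1) (v$3) (h v) (v$2) (v$4) \<zeta>"

text \<open>\<open>s\<close> is the function \<open>g\<close> or \<open>h\<close> given by the implicit function theorem near \<open>v\<close>.\<close>

definition solves_WJ ::
  "(whitham_par \<Rightarrow> real) \<Rightarrow> (real^4 \<Rightarrow> whitham_par) \<Rightarrow> (real^4 \<Rightarrow> real) \<Rightarrow> real^4 \<Rightarrow> whitham_par \<Rightarrow> bool" where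
  "solves_WJ W \<Theta> s v q \<longleftrightarrow> s differentiable (at v) \<and> \<Theta> v = q \<and>
     (\<forall>\<^sub>F v' in nhds v. partial jJ W (\<Theta> v') = 0)"

definition whitham_system :: "(whitham_par \<Rightarrow> real) \<Rightarrow> whitham_par \<Rightarrow> real^4^4 \<Rightarrow> real^4^4 \<Rightarrow> bool" where
  "whitham_system W q A a \<longleftrightarrow>
     (let W\<^sub>H\<^sub>H = partial jH (partial jH W) q; W\<^sub>H\<^sub>J = partial jH (partial jJ W) q;
          W\<^sub>J\<^sub>J = partial jJ (partial jJ W) q; \<zeta> = q$j\<zeta> in
      (W\<^sub>H\<^sub>J \<noteq> 0 \<and>
        (\<exists>g. let v = vector [q$jJ, q$j\<gamma>, q$jU, q$j\<beta>]; \<Theta> = subst_H \<zeta> g in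
           solves_WJ W \<Theta> g v q \<and> A = whitham_A W \<Theta> v W\<^sub>H\<^sub>J \<and> a = whitham_a W \<Theta> v W\<^sub>H\<^sub>J)) \<or>
      (W\<^sub>J\<^sub>J \<noteq> 0 \<and> W\<^sub>H\<^sub>H \<noteq> 0 \<and>
        (\<exists>h. let v = vector [q$jH, q$j\<gamma>, q$jU, q$j\<beta>]; \<Theta> = subst_J \<zeta> h in
           solves_WJ W \<Theta> h v q \<and> A = whitham_A W \<Theta> v W\<^sub>J\<^sub>J \<and> a = whitham_a W \<Theta> v W\<^sub>J\<^sub>J)))"

definition characteristic :: "real^4^4 \<Rightarrow> real^4^4 \<Rightarrow> complex \<Rightarrow> bool" where
  "characteristic A a c \<longleftrightarrow>
     (\<exists>x :: complex^4. x \<noteq> 0 \<and> map_matrix complex_of_real (matrix_inv A ** a) *v x = c *s x)"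

end

theory Submission
  imports Defs "HOL-Complex_Analysis.Great_Picard"
begin

text \<open>
  Since \<open>W = K / \<pi>\<close>, the pencil \<open>a - c A\<close> can be written in the differentials \<open>dE, d\<kappa>, d\<omega>, dU\<close>
  of the linear parameters. With \<open>\<delta> = c - U\<close>, a kernel vector of it (tangent to \<open>W\<^sub>J = 0\<close>) is the
  same as a kernel vector of the symmetric system
    \<open>\<delta> dK\<^sub>E + T dU = 0\<close>, \<open>\<delta> dK\<^sub>\<kappa> - T d\<omega> + \<delta> T dU / 2 = 0\<close>, \<open>\<delta> dK\<^sub>\<omega> - T d\<kappa> = 0\<close>,
    \<open>T dE + \<delta> T d\<kappa> / 2 + (\<delta> K\<^sub>\<omega> / 2 - \<kappa> T) dU = 0\<close>.
  Eliminating \<open>dE, d\<kappa>\<close>, which is possible because \<open>\<sigma> \<noteq> 0\<close>, leaves a \<open>2 \<times> 2\<close> system whose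
  determinant is, up to a nonzero factor, the normal form at \<open>lam = - i \<mu> \<delta>\<close>; the entry \<open>d\<^sub>0\<close> is
  brought to this shape by the scaling identity of \<open>K\<close>. In the same way the kernel of \<open>A\<close> is the
  kernel of the matrix defining \<open>D\<close>. Instability follows from Hurwitz's theorem, because with
  \<open>lam = \<mu> z\<close> the higher-order terms are a small perturbation of the normal form.
\<close>

section \<open>Symmetric linear systems\<close>

lemma symmetric_2x2_kernel_iff:
  fixes a b d :: "'a::field"
  shows "(\<exists>x y. (x \<noteq> 0 \<or> y \<noteq> 0) \<and> a * x + b * y = 0 \<and> b * x + d * y = 0) \<longleftrightarrow> a * d - b * b = 0"
proof
  assume "\<exists>x y. (x \<noteq> 0 \<or> y \<noteq> 0) \<and> a * x + b * y = 0 \<and> b * x + d * y = 0"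
  then obtain x y where xy: "x \<noteq> 0 \<or> y \<noteq> 0" "a * x + b * y = 0" "b * x + d * y = 0" by blast
  have "(a * d - b * b) * x = 0" "(a * d - b * b) * y = 0"
    using xy(2,3) by algebra+
  then show "a * d - b * b = 0" using xy(1) by auto
next
  assume det: "a * d - b * b = 0"
  show "\<exists>x y. (x \<noteq> 0 \<or> y \<noteq> 0) \<and> a * x + b * y = 0 \<and> b * x + d * y = 0"
  proof (cases "a = 0 \<and> b = 0")
    case True
    then show ?thesis by (intro exI[of _ 1] exI[of _ 0]) auto
  next
    case False
    \<comment> \<open>The vector \<open>(-b, a)\<close> solves the first equation identically and is
      nonzero here; the second equation then reads \<open>a * d - b * b = 0\<close>.\<close>
    then show ?thesis using det
      by (intro exI[of _ "-b"] exI[of _ a]) (auto simp: algebra_simps)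
  qed
qed

text \<open>Since \<open>G * d\<close> is nonzero, Cramer's rule gives \<open>e\<close> and
  \<open>k\<close> from the first two equations in terms of \<open>w\<close> and \<open>u\<close>.
  Substituting them into the last two and multiplying by \<open>- (G * d)\<close> leaves a symmetric
  system in \<open>w\<close>, \<open>u\<close>: the Schur complement, cleared of
  denominators.\<close>

lemma schur_kernel_iff:
  fixes d :: "'a::field"
  assumes d: "d \<noteq> 0" and G: "g11 * g22 - g12 * g12 \<noteq> 0"
  defines "G \<equiv> g11 * g22 - g12 * g12"
  shows "(\<exists>e k w u. (e \<noteq> 0 \<or> k \<noteq> 0 \<or> w \<noteq> 0 \<or> u \<noteq> 0) \<and>
      d * (g11 * e + g12 * k) + p1 * w + r1 * u = 0 \<and>
      d * (g12 * e + g22 * k) + p2 * w + r2 * u = 0 \<and>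
      p1 * e + p2 * k + c1 * w = 0 \<and> r1 * e + r2 * k + c2 * u = 0) \<longleftrightarrow>
    (g22 * p1 * p1 - 2 * g12 * p1 * p2 + g11 * p2 * p2 - G * d * c1) *
    (g22 * r1 * r1 - 2 * g12 * r1 * r2 + g11 * r2 * r2 - G * d * c2) -
    (g22 * p1 * r1 - g12 * (p1 * r2 + p2 * r1) + g11 * p2 * r2) *
    (g22 * p1 * r1 - g12 * (p1 * r2 + p2 * r1) + g11 * p2 * r2) = 0"
    (is "?L \<longleftrightarrow> ?q11 * ?q22 - ?q12 * ?q12 = 0")
proof -
  have Gd: "G * d \<noteq> 0" using d G by (simp add: G_def)
  have "?L \<longleftrightarrow> (\<exists>w u. (w \<noteq> 0 \<or> u \<noteq> 0) \<and> ?q11 * w + ?q12 * u = 0 \<and> ?q12 * w + ?q22 * u = 0)"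
  proof
    assume ?L
    then obtain e k w u where nz: "e \<noteq> 0 \<or> k \<noteq> 0 \<or> w \<noteq> 0 \<or> u \<noteq> 0"
      and eqs: "d * (g11 * e + g12 * k) + p1 * w + r1 * u = 0"
        "d * (g12 * e + g22 * k) + p2 * w + r2 * u = 0"
        "p1 * e + p2 * k + c1 * w = 0" "r1 * e + r2 * k + c2 * u = 0" by blast
    have e: "G * d * e = g12 * (p2 * w + r2 * u) - g22 * (p1 * w + r1 * u)"
      using eqs(1,2) unfolding G_def by algebra
    have k: "G * d * k = g12 * (p1 * w + r1 * u) - g11 * (p2 * w + r2 * u)"
      using eqs(1,2) unfolding G_def by algebra
    have "?q11 * w + ?q12 * u = - (G * d * (p1 * e + p2 * k + c1 * w))"
      using e k by algebra
    moreover have "?q12 * w + ?q22 * u = - (G * d * (r1 * e + r2 * k + c2 * u))"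
      using e k by algebra
    \<comment> \<open>If \<open>w\<close> and \<open>u\<close> both vanished, Cramer's formulas
      would force \<open>e\<close> and \<open>k\<close> to vanish as well.\<close>
    moreover have "w \<noteq> 0 \<or> u \<noteq> 0"
      using nz e k Gd by auto
    ultimately show "\<exists>w u. (w \<noteq> 0 \<or> u \<noteq> 0) \<and> ?q11 * w + ?q12 * u = 0 \<and> ?q12 * w + ?q22 * u = 0"
      using eqs(3,4) by (intro exI[of _ w] exI[of _ u]) simp
  next
    assume "\<exists>w u. (w \<noteq> 0 \<or> u \<noteq> 0) \<and> ?q11 * w + ?q12 * u = 0 \<and> ?q12 * w + ?q22 * u = 0"
    then obtain w u where nz: "w \<noteq> 0 \<or> u \<noteq> 0"
      and q: "?q11 * w + ?q12 * u = 0" "?q12 * w + ?q22 * u = 0" by blast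
    define e where "e = (g12 * (p2 * w + r2 * u) - g22 * (p1 * w + r1 * u)) / (G * d)"
    define k where "k = (g12 * (p1 * w + r1 * u) - g11 * (p2 * w + r2 * u)) / (G * d)"
    have e: "G * d * e = g12 * (p2 * w + r2 * u) - g22 * (p1 * w + r1 * u)"
      and k: "G * d * k = g12 * (p1 * w + r1 * u) - g11 * (p2 * w + r2 * u)"
      using Gd by (simp_all add: e_def k_def)
    have "G * d * (d * (g11 * e + g12 * k) + p1 * w + r1 * u) = 0"
      using e k unfolding G_def by algebra
    moreover have "G * d * (d * (g12 * e + g22 * k) + p2 * w + r2 * u) = 0"
      using e k unfolding G_def by algebra
    moreover have "G * d * (p1 * e + p2 * k + c1 * w) = 0"
      using e k q(1) by algebra
    moreover have "G * d * (r1 * e + r2 * k + c2 * u) = 0"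
      using e k q(2) by algebra
    ultimately show ?L using Gd nz by (intro exI[of _ e] exI[of _ k] exI[of _ w] exI[of _ u]) simp
  qed
  then show ?thesis by (simp only: symmetric_2x2_kernel_iff)
qed

section \<open>Partial derivatives and the normal form\<close>

lemma sum_wave_index: "(\<Sum>i\<in>UNIV. g i) = g iE + g i\<kappa> + g i\<omega> + g i\<zeta>"
proof -
  have U: "(UNIV :: wave_index set) = {iE, i\<kappa>, i\<omega>, i\<zeta>}" using wave_index.exhaust by auto
  show ?thesis unfolding U by (simp add: add.assoc)
qed

lemma partial_eq:
  assumes "(\<Phi> has_derivative D) (at x)"
  shows "partial i \<Phi> x = D (axis i 1)"
proof -
  have "((\<lambda>t. x + t *\<^sub>R axis i 1) has_derivative (\<lambda>t. t *\<^sub>R axis i 1)) (at 0)"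
    by (auto intro!: derivative_eq_intros)
  moreover have "(\<Phi> has_derivative D) (at (x + 0 *\<^sub>R axis i 1))" using assms by simp
  ultimately have "((\<lambda>t. \<Phi> (x + t *\<^sub>R axis i 1)) has_derivative (\<lambda>t. D (t *\<^sub>R axis i 1))) (at 0)"
    by (rule has_derivative_compose)
  moreover have "(\<lambda>t. D (t *\<^sub>R axis i 1)) = (*) (D (axis i 1))"
    using has_derivative_bounded_linear[OF assms] by (auto simp: linear_simps)
  ultimately show ?thesis
    unfolding partial_def by (metis DERIV_imp_deriv has_field_derivative_def)
qed

lemma has_derivative_partial:
  assumes "(\<Phi> has_derivative D) (at x)"
  shows "(\<Phi> has_derivative (\<lambda>h. \<Sum>i\<in>UNIV. partial i \<Phi> x * h $ i)) (at x)"
proof -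
  have "D h = (\<Sum>i\<in>UNIV. partial i \<Phi> x * h $ i)" for h
  proof -
    have lin: "linear D" using assms has_derivative_linear by blast
    have "h = (\<Sum>i\<in>UNIV. h $ i *\<^sub>R axis i 1)"
      using basis_expansion[of h] by (simp add: scalar_mult_eq_scaleR)
    then have "D h = (\<Sum>i\<in>UNIV. h $ i *\<^sub>R D (axis i 1))"
      by (metis (no_types, lifting) lin linear_sum linear_scale sum.cong)
    then show ?thesis by (simp add: partial_eq[OF assms] mult.commute)
  qed
  then have "D = (\<lambda>h. \<Sum>i\<in>UNIV. partial i \<Phi> x * h $ i)" by auto
  then show ?thesis using assms by simp
qed

lemma partial_cmult:
  assumes "\<Phi> differentiable (at x)"
  shows "partial i (\<lambda>x. c * \<Phi> x) x = c * partial i \<Phi> x"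
proof -
  obtain D where D: "(\<Phi> has_derivative D) (at x)" using assms differentiable_def by blast
  then have "((\<lambda>x. c * \<Phi> x) has_derivative (\<lambda>h. c * D h)) (at x)"
    by (auto intro!: derivative_eq_intros)
  then show ?thesis using partial_eq D by metis
qed

lemma C1_on_has_derivative:
  assumes "C1_on N K" "p \<in> N"
  shows "(K has_derivative (\<lambda>h. \<Sum>i\<in>UNIV. partial i K p * h $ i)) (at p)"
  using assms has_derivative_partial unfolding C1_on_def by blast

lemma C2_on_has_derivative:
  assumes "C2_on N K" "p \<in> N"
  shows "(K has_derivative (\<lambda>h. \<Sum>i\<in>UNIV. partial i K p * h $ i)) (at p)"
    and "(partial j K has_derivative (\<lambda>h. \<Sum>i\<in>UNIV. partial i (partial j K) p * h $ i)) (at p)"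
  using assms C1_on_has_derivative unfolding C2_on_def by blast+

lemma C2_on_partial_commute:
  assumes "C2_on N K" "p \<in> N"
  shows "partial i (partial j K) p = partial j (partial i K) p"
  using assms unfolding C2_on_def by blast

lemma partial_period_quasimomentum_mass:
  assumes "C2_on N K" "p \<in> N"
  shows "partial i (period K) p = partial i (partial iE K) p"
    and "partial i (quasimomentum K) p = - partial i (partial i\<kappa> K) p"
    and "partial i (mass K) p = - 2 * partial i (partial i\<omega> K) p"
proof -
  have diff: "partial j K differentiable (at p)" for j
    using C2_on_has_derivative(2)[OF assms] differentiable_def by blast
  show "partial i (period K) p = partial i (partial iE K) p" by (simp add: period_def)
  show "partial i (quasimomentum K) p = - partial i (partial i\<kappa> K) p"
    using partial_cmult[OF diff, of i "-1"] by (simp add: quasimomentum_def[abs_def])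
  show "partial i (mass K) p = - 2 * partial i (partial i\<omega> K) p"
    using partial_cmult[OF diff, of i "-2"] by (simp add: mass_def[abs_def])
qed

text \<open>Putting \<open>lam = - \<i> * of_real \<mu> * \<delta>\<close> turns the entries of the
  normal form, up to sign, into \<open>G * of_real \<mu> ^ 2\<close> times the Schur complement
  entries of \<open>schur_kernel_iff\<close> for the displayed system. The value
  \<open>lam = 0\<close> is treated apart because the elimination divides by \<delta>; there the
  determinant is an explicit nonzero monomial.\<close>

lemma normal_form_zero_iff:
  fixes K :: "wave_par \<Rightarrow> real" and \<delta> :: complex and p :: wave_par
  assumes C2: "C2_on N K" "p \<in> N"
    and euler_E: "p$iE * partial iE (partial iE K) p + p$i\<kappa> / 2 * partial iE (partial i\<kappa> K) p
      + p$i\<omega> * partial iE (partial i\<omega> K) p + p$i\<zeta> * partial iE (partial i\<zeta> K) p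
      = - partial iE K p / 2"
    and euler_\<kappa>: "p$iE * partial iE (partial i\<kappa> K) p + p$i\<kappa> / 2 * partial i\<kappa> (partial i\<kappa> K) p
      + p$i\<omega> * partial i\<kappa> (partial i\<omega> K) p + p$i\<zeta> * partial i\<kappa> (partial i\<zeta> K) p = 0"
    and sigma: "nf_sigma K p \<noteq> 0"
  defines "k \<equiv> \<lambda>i j. complex_of_real (partial i (partial j K) p)"
    and "T \<equiv> complex_of_real (partial iE K p)"
    and "k\<omega> \<equiv> complex_of_real (partial i\<omega> K p)"
    and "\<kappa> \<equiv> complex_of_real (p$i\<kappa>)"
  shows normal_form_at_0: "\<mu> \<noteq> 0 \<Longrightarrow> T \<noteq> 0 \<Longrightarrow> normal_form K p 0 \<mu> \<noteq> 0"
    and "\<delta> \<noteq> 0 \<Longrightarrow> \<mu> \<noteq> 0 \<Longrightarrow> normal_form K p (- \<i> * of_real \<mu> * \<delta>) \<mu> = 0 \<longleftrightarrow>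
      (\<exists>e x w u. (e \<noteq> 0 \<or> x \<noteq> 0 \<or> w \<noteq> 0 \<or> u \<noteq> 0) \<and>
        \<delta> * (k iE iE * e + k iE i\<kappa> * x) + \<delta> * k iE i\<omega> * w + T * u = 0 \<and>
        \<delta> * (k iE i\<kappa> * e + k i\<kappa> i\<kappa> * x) + (\<delta> * k i\<kappa> i\<omega> - T) * w + \<delta> * T / 2 * u = 0 \<and>
        \<delta> * k iE i\<omega> * e + (\<delta> * k i\<kappa> i\<omega> - T) * x + \<delta> * k i\<omega> i\<omega> * w = 0 \<and>
        T * e + \<delta> * T / 2 * x + (\<delta> * k\<omega> / 2 - \<kappa> * T) * u = 0)"
proof -
  define E \<omega> \<zeta> where par: "E = p$iE" "\<omega> = p$i\<omega>" "\<zeta> = p$i\<zeta>"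
  define t where "t = partial iE K p"
  define kw where "kw = partial i\<omega> K p"
  define ee ek ew ez kk kv kz ww where
    hess: "ee = partial iE (partial iE K) p" "ek = partial iE (partial i\<kappa> K) p"
     "ew = partial iE (partial i\<omega> K) p" "ez = partial iE (partial i\<zeta> K) p"
     "kk = partial i\<kappa> (partial i\<kappa> K) p" "kv = partial i\<kappa> (partial i\<omega> K) p"
     "kz = partial i\<kappa> (partial i\<zeta> K) p" "ww = partial i\<omega> (partial i\<omega> K) p"
  note sym = C2_on_partial_commute[OF C2]
  have sym': "partial i\<kappa> (partial iE K) p = ek" "partial i\<omega> (partial iE K) p = ew"
     "partial i\<zeta> (partial iE K) p = ez" "partial i\<omega> (partial i\<kappa> K) p = kv"
     "partial i\<zeta> (partial i\<kappa> K) p = kz"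
    unfolding hess by (rule sym)+
  note par_simps = partial_period_quasimomentum_mass[OF C2]
  define g where "g = ee * kk - ek * ek"
  have \<sigma>: "nf_sigma K p = - g"
    by (simp add: nf_sigma_def jac_def par_simps sym' g_def flip: hess)
  have \<gamma>: "nf_gamma K p = kk * ew - ek * kv"
    by (simp add: nf_gamma_def jac_def par_simps sym' flip: hess)
  have \<rho>: "nf_rho K p = ee * kv - ew * ek"
    by (simp add: nf_rho_def jac_def par_simps sym' flip: hess)
  have \<xi>: "nf_xi K p = kk * ez - ek * kz"
    by (simp add: nf_xi_def jac_def par_simps sym' flip: hess)
  have \<tau>: "nf_tau K p = t * ek / 2" and \<nu>: "nf_nu K p = - (t * ee / 2)"
    by (simp_all add: nf_tau_def nf_nu_def par_simps sym' t_def period_def flip: hess)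
  \<comment> \<open>The scaling identities enter here: \<open>kk\<close> times the one for E minus
    \<open>ek\<close> times the one for \<kappa>. The terms with \<open>p$i\<kappa>\<close>
    cancel.\<close>
  have d0: "\<omega> * nf_gamma K p + \<zeta> * nf_xi K p - E * nf_sigma K p = - (t * kk) / 2"
  proof -
    have "E * ee + p$i\<kappa> / 2 * ek + \<omega> * ew + \<zeta> * ez = - t / 2"
      "E * ek + p$i\<kappa> / 2 * kk + \<omega> * kv + \<zeta> * kz = 0"
      using euler_E euler_\<kappa> by (simp_all add: par hess t_def)
    then show ?thesis unfolding \<sigma> \<gamma> \<xi> g_def by algebra
  qed
  have m: "mass K p = - 2 * kw" by (simp add: mass_def kw_def)
  have per: "period K p = t" by (simp add: period_def t_def)
  have mp: "partial iE (mass K) p = - 2 * ew" "partial i\<kappa> (mass K) p = - 2 * kv"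
     "partial i\<omega> (mass K) p = - 2 * ww"
    by (simp_all add: par_simps sym' flip: hess)
  have g0: "g \<noteq> 0" using sigma \<sigma> by simp
  let ?c = complex_of_real
  \<comment> \<open>The target system in the notation of \<open>schur_kernel_iff\<close>:
    \<open>p1\<close>, \<open>p2\<close> couple the eliminated pair to \<open>w\<close>, and
    \<open>r1\<close>, \<open>r2\<close> couple it to \<open>u\<close>.\<close>
  define G p1 p2 r1 r2 c1 c2 where
    "G = ?c ee * ?c kk - ?c ek * ?c ek" and
    p1: "p1 = \<delta> * ?c ew" and p2: "p2 = \<delta> * ?c kv - ?c t" and
    r1: "r1 = ?c t" and r2: "r2 = \<delta> * ?c t / 2" and
    c1: "c1 = \<delta> * ?c ww" and c2: "c2 = \<delta> * ?c kw / 2 - \<kappa> * ?c t"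
  define q11 q12 q22 where
    q11: "q11 = ?c kk * p1 * p1 - 2 * ?c ek * p1 * p2 + ?c ee * p2 * p2 - G * \<delta> * c1" and
    q12: "q12 = ?c kk * p1 * r1 - ?c ek * (p1 * r2 + p2 * r1) + ?c ee * p2 * r2" and
    q22: "q22 = ?c kk * r1 * r1 - 2 * ?c ek * r1 * r2 + ?c ee * r2 * r2 - G * \<delta> * c2"
  have G: "G = ?c g" by (simp add: G_def g_def)
  \<comment> \<open>With everything in terms of the Hessian entries, \<open>t\<close> and
    \<open>kw\<close>, the comparisons below are polynomial identities.\<close>
  have nf: "normal_form K p lam \<mu> =
     (lam^2 * ?c (g / 2 * ((kk * ew - ek * kv) * (- 2 * ew) + (ee * kv - ew * ek) * (- 2 * kv) + (- g) * (- 2 * ww)))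
      + lam * ?c \<mu> * (\<i> * ?c (2 * (- g) * (ee * kv - ew * ek) * t))
      + (?c \<mu>)^2 * ?c (2 * (- g) * (- (t * ee / 2)) * t)) *
     (lam^2 * ?c (g / 2 * (- (t * ee / 2) * t + (- g) / 2 * (- 2 * kw)))
      + lam * ?c \<mu> * (\<i> * ?c (- g * t * (2 * (t * ek / 2) + - g * p$i\<kappa>)))
      + (?c \<mu>)^2 * ?c (2 * (- g) * t * (- (t * kk) / 2))) -
     (lam^2 * ?c (g * (ee * kv - ew * ek) * t / 2)
      + lam * ?c \<mu> * (\<i> * ?c (- g * t * (- (t * ee / 2) + (kk * ew - ek * kv))))
      + (?c \<mu>)^2 * ?c (2 * (- g) * (t * ek / 2) * t))^2" for lam \<mu>
    unfolding normal_form_def Let_def det_2 d0[unfolded par]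
    by (simp add: \<sigma> \<gamma>[symmetric] \<rho>[symmetric] \<tau> \<nu> m per mp power2_eq_square d0[unfolded par \<sigma>, simplified])
  have "normal_form K p 0 \<mu> = ?c (\<mu> ^ 4 * g ^ 3 * t ^ 4)"
    unfolding nf by (simp add: g_def) algebra
  then show "\<mu> \<noteq> 0 \<Longrightarrow> T \<noteq> 0 \<Longrightarrow> normal_form K p 0 \<mu> \<noteq> 0"
    using g0 by (simp add: T_def t_def)
  have I: "\<i> * \<i> = -1" by simp
  \<comment> \<open>Entry by entry; the off-diagonal entry carries a minus sign, which disappears in
    its square.\<close>
  have main: "normal_form K p (- \<i> * of_real \<mu> * \<delta>) \<mu> = (G * of_real \<mu> ^ 2)\<^sup>2 * (q11 * q22 - q12 * q12)" for \<mu>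
  proof -
    let ?l = "- \<i> * of_real \<mu> * \<delta>"
    have "?l^2 * ?c (g / 2 * ((kk * ew - ek * kv) * (- 2 * ew) + (ee * kv - ew * ek) * (- 2 * kv) + (- g) * (- 2 * ww)))
      + ?l * ?c \<mu> * (\<i> * ?c (2 * (- g) * (ee * kv - ew * ek) * t))
      + (?c \<mu>)^2 * ?c (2 * (- g) * (- (t * ee / 2)) * t) = G * of_real \<mu> ^ 2 * q11"
      unfolding G q11 p1 p2 c1 by (simp add: g_def) (use I in algebra)
    moreover have "?l^2 * ?c (g / 2 * (- (t * ee / 2) * t + (- g) / 2 * (- 2 * kw)))
      + ?l * ?c \<mu> * (\<i> * ?c (- g * t * (2 * (t * ek / 2) + - g * p$i\<kappa>)))
      + (?c \<mu>)^2 * ?c (2 * (- g) * t * (- (t * kk) / 2)) = G * of_real \<mu> ^ 2 * q22"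
      unfolding G q22 r1 r2 c2 \<kappa>_def by (simp add: g_def divide_simps) (use I in algebra)
    moreover have "?l^2 * ?c (g * (ee * kv - ew * ek) * t / 2)
      + ?l * ?c \<mu> * (\<i> * ?c (- g * t * (- (t * ee / 2) + (kk * ew - ek * kv))))
      + (?c \<mu>)^2 * ?c (2 * (- g) * (t * ek / 2) * t) = - G * of_real \<mu> ^ 2 * q12"
      unfolding G q12 p1 p2 r1 r2 by (simp add: g_def) (use I in algebra)
    ultimately show ?thesis unfolding nf by algebra
  qed
  assume "\<delta> \<noteq> 0" "\<mu> \<noteq> 0"
  then have "normal_form K p (- \<i> * of_real \<mu> * \<delta>) \<mu> = 0 \<longleftrightarrow> q11 * q22 - q12 * q12 = 0"
    using main g0 by (simp add: G)
  also have "\<dots> \<longleftrightarrow> (\<exists>e x w u. (e \<noteq> 0 \<or> x \<noteq> 0 \<or> w \<noteq> 0 \<or> u \<noteq> 0) \<and>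
      \<delta> * (?c ee * e + ?c ek * x) + p1 * w + r1 * u = 0 \<and>
      \<delta> * (?c ek * e + ?c kk * x) + p2 * w + r2 * u = 0 \<and>
      p1 * e + p2 * x + c1 * w = 0 \<and> r1 * e + r2 * x + c2 * u = 0)"
    unfolding q11 q12 q22 G_def
    by (rule schur_kernel_iff[symmetric]) (use \<open>\<delta> \<noteq> 0\<close> g0 G G_def in auto)
  finally show "normal_form K p (- \<i> * of_real \<mu> * \<delta>) \<mu> = 0 \<longleftrightarrow>
      (\<exists>e x w u. (e \<noteq> 0 \<or> x \<noteq> 0 \<or> w \<noteq> 0 \<or> u \<noteq> 0) \<and>
        \<delta> * (k iE iE * e + k iE i\<kappa> * x) + \<delta> * k iE i\<omega> * w + T * u = 0 \<and>
        \<delta> * (k iE i\<kappa> * e + k i\<kappa> i\<kappa> * x) + (\<delta> * k i\<kappa> i\<omega> - T) * w + \<delta> * T / 2 * u = 0 \<and>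
        \<delta> * k iE i\<omega> * e + (\<delta> * k i\<kappa> i\<omega> - T) * x + \<delta> * k i\<omega> i\<omega> * w = 0 \<and>
        T * e + \<delta> * T / 2 * x + (\<delta> * k\<omega> / 2 - \<kappa> * T) * u = 0)"
    by (simp add: p1 p2 r1 r2 c1 c2 k_def T_def k\<omega>_def kw_def t_def flip: hess)
qed

section \<open>The action\<close>

text \<open>The difference quotient at \<open>a\<close> tends to the nonzero derivative, so
  \<open>G\<close> cannot vanish at nearby points other than \<open>a\<close>.\<close>

lemma simple_root_isolated:
  fixes G :: "real \<Rightarrow> real"
  assumes "G differentiable (at a)" "simple_root G a"
  shows "\<forall>\<^sub>F x in nhds a. G x = 0 \<longrightarrow> x = a"
proof -
  have "(G has_field_derivative deriv G a) (at a)"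
    using assms(1) by (simp add: DERIV_deriv_iff_real_differentiable)
  then have "((\<lambda>y. (G y - G a) / (y - a)) \<longlongrightarrow> deriv G a) (at a)"
    by (simp add: has_field_derivative_iff)
  then have "\<forall>\<^sub>F y in at a. (G y - G a) / (y - a) \<noteq> 0"
    using assms(2) tendsto_imp_eventually_ne unfolding simple_root_def by blast
  then have "\<forall>\<^sub>F y in at a. G y \<noteq> 0"
    by eventually_elim (use assms(2) in \<open>auto simp: simple_root_def\<close>)
  then show ?thesis by (auto simp: eventually_at_filter elim: eventually_mono)
qed

lemma profile_rhs_differentiable:
  assumes F: "\<forall>x>0. (F has_real_derivative f x) (at x)" and "x > 0"
  shows "profile_rhs F p differentiable (at x)"
proof -
  have "(F has_real_derivative f (x\<^sup>2)) (at (x\<^sup>2))" using assms by simp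
  then have "((\<lambda>x. F (x\<^sup>2)) has_real_derivative f (x\<^sup>2) * (2 * x)) (at x)"
    by (rule DERIV_chain2) (auto intro!: derivative_eq_intros)
  then have "(\<lambda>x. F (x\<^sup>2)) differentiable (at x)"
    using real_differentiable_def by blast
  then show ?thesis unfolding profile_rhs_def using \<open>x > 0\<close> by (auto intro!: derivative_intros)
qed

text \<open>For \<open>s > 0\<close> the profile function at \<open>c s\<close> is a positive
  multiple of the one at \<open>p\<close>, so both have the same zeros. The root selected at
  \<open>c s\<close> is therefore a zero for \<open>p\<close>, close to the selected one by
  continuity, and simple zeros are isolated.\<close>

lemma root_branch_scaling:
  assumes branch: "root_branch F N am ap" and F: "\<forall>x>0. (F has_real_derivative f x) (at x)"
    and p: "p \<in> N" and cont: "isCont c a" and c0: "c a = p"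
    and scale: "\<And>s x. profile_rhs F (c s) x = (r s)\<^sup>2 * profile_rhs F p x"
    and r: "\<And>s. s > 0 \<Longrightarrow> r s > 0" and a: "(a::real) > 0"
  shows "\<forall>\<^sub>F s in nhds a. am (c s) = am p \<and> ap (c s) = ap p"
proof -
  have adm: "admissible_roots F p (am p) (ap p)" if "p \<in> N" for p
    using branch that by (simp add: root_branch_def)
  have N: "open N" "continuous_on N am" "continuous_on N ap"
    using branch by (simp_all add: root_branch_def)
  have c_lim: "filterlim c (nhds p) (nhds a)"
    using cont c0 by (metis isCont_def tendsto_nhds_iff)
  have inN: "\<forall>\<^sub>F s in nhds a. c s \<in> N"
    by (rule eventually_compose_filterlim[OF eventually_nhds_in_open[OF N(1) p] c_lim])
  have pos: "\<forall>\<^sub>F s in nhds a. s > 0"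
    using eventually_nhds_in_open[of "{0<..}" a] a by simp
  \<comment> \<open>One argument for both endpoints, with \<open>b\<close> standing for
    \<open>am\<close> or \<open>ap\<close>.\<close>
  have main: "\<forall>\<^sub>F s in nhds a. b (c s) = b p"
    if b: "continuous_on N b" "b p > 0"
      and root: "\<And>p. p \<in> N \<Longrightarrow> simple_root (profile_rhs F p) (b p)" for b :: "wave_par \<Rightarrow> real"
  proof -
    have "isCont b p" using b N(1) p continuous_on_eq_continuous_at by blast
    then have lim: "filterlim (\<lambda>s. b (c s)) (nhds (b p)) (nhds a)"
      using c_lim by (metis filterlim_compose isCont_def tendsto_nhds_iff)
    have "\<forall>\<^sub>F x in nhds (b p). profile_rhs F p x = 0 \<longrightarrow> x = b p"
      using simple_root_isolated profile_rhs_differentiable[OF F b(2)] root p by blast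
    with lim have "\<forall>\<^sub>F s in nhds a. profile_rhs F p (b (c s)) = 0 \<longrightarrow> b (c s) = b p"
      by (rule eventually_compose_filterlim[rotated])
    with inN pos show ?thesis
    proof eventually_elim
      case (elim s)
      have "(r s)\<^sup>2 * profile_rhs F p (b (c s)) = 0"
        using root[OF elim(1)] scale[of s] by (simp add: simple_root_def)
      then show ?case using elim(3) r[OF elim(2)] by simp
    qed
  qed
  have "am p > 0" "ap p > 0" using adm[OF p] by (auto simp: admissible_roots_def)
  then show ?thesis
    using main[of am] main[of ap] N adm eventually_conj unfolding admissible_roots_def by blast
qed

text \<open>The weights come from the scaling \<open>(E, \<kappa>, \<omega>, \<zeta>) \<mapsto> (s\<^sup>2 E, s \<kappa>, s\<^sup>2 \<omega>, s\<^sup>2 \<zeta>)\<close>, which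
  multiplies the action by \<open>s\<close> because the isolated roots cannot move.\<close>

lemma action_euler:
  assumes branch: "root_branch F N am ap" and regular: "well_behaved f F N am ap" and p: "p \<in> N"
  defines "K \<equiv> action F am ap"
  shows "p$iE * partial iE K p + p$i\<kappa> / 2 * partial i\<kappa> K p
    + p$i\<omega> * partial i\<omega> K p + p$i\<zeta> * partial i\<zeta> K p = K p / 2"
proof -
  have F: "\<forall>x>0. (F has_real_derivative f x) (at x)" and C2: "C2_on N K"
    using regular by (auto simp: well_behaved_def K_def)
  \<comment> \<open>\<open>u\<close> is the \<kappa> component of \<open>p\<close>, so that
    \<open>c s\<close> multiplies \<kappa> by \<open>s\<close> and the other parameters by
    \<open>s\<^sup>2\<close>.\<close>
  define u where "u = p$i\<kappa> *\<^sub>R (axis i\<kappa> 1 :: wave_par)"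
  define c where "c s = s\<^sup>2 *\<^sub>R (p - u) + s *\<^sub>R u" for s :: real
  have comp: "c s $ iE = s\<^sup>2 * p $ iE" "c s $ i\<kappa> = s * p $ i\<kappa>" "c s $ i\<omega> = s\<^sup>2 * p $ i\<omega>"
    "c s $ i\<zeta> = s\<^sup>2 * p $ i\<zeta>" for s
    by (simp_all add: c_def u_def axis_def)
  have scale: "profile_rhs F (c s) x = s\<^sup>2 * profile_rhs F p x" for s x
    by (simp add: profile_rhs_def comp algebra_simps power_mult_distrib)
  have c1: "c 1 = p" by (simp add: c_def)
  have dc: "(c has_derivative (\<lambda>t. t *\<^sub>R (2 *\<^sub>R (p - u) + u))) (at 1)"
    unfolding c_def by (auto intro!: derivative_eq_intros simp: vec_eq_iff algebra_simps)
  from has_derivative_continuous[OF dc] have "isCont c 1" .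
  then have "\<forall>\<^sub>F s in nhds 1. am (c s) = am p \<and> ap (c s) = ap p"
    using root_branch_scaling[OF branch F p, where c = c and a = 1 and r = "\<lambda>s. s"] c1 scale by simp
  moreover have "\<forall>\<^sub>F s in nhds (1::real). s > 0"
    using eventually_nhds_in_open[of "{0::real<..}" 1] by simp
  ultimately have "\<forall>\<^sub>F s in nhds 1. K (c s) = s * K p"
    by eventually_elim (simp add: K_def action_def scale real_sqrt_mult)
  then obtain S where S: "open S" "1 \<in> S" "\<And>s. s \<in> S \<Longrightarrow> s * K p = K (c s)"
    unfolding eventually_nhds by metis
  \<comment> \<open>The relation \<open>K (c s) = s * K p\<close> is differentiated at
    \<open>s = 1\<close> and compared with the chain rule; the result is twice the claim.\<close>
  have "((\<lambda>s. K (c s)) has_derivative (\<lambda>t. t * K p)) (at 1)"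
    by (rule has_derivative_transform_within_open[OF _ S(1,2), where f = "\<lambda>s. s * K p"])
      (auto intro!: derivative_eq_intros simp: S(3))
  moreover have "((\<lambda>s. K (c s)) has_derivative
     (\<lambda>t. \<Sum>i\<in>UNIV. partial i K p * (t *\<^sub>R (2 *\<^sub>R (p - u) + u)) $ i)) (at 1)"
    by (rule has_derivative_compose[OF dc]) (unfold c1, rule C2_on_has_derivative(1)[OF C2 p])
  ultimately have "(\<lambda>t. t * K p) = (\<lambda>t. \<Sum>i\<in>UNIV. partial i K p * (t *\<^sub>R (2 *\<^sub>R (p - u) + u)) $ i)"
    by (rule has_derivative_unique)
  from fun_cong[OF this, of 1] have "K p = (\<Sum>i\<in>UNIV. partial i K p * (2 *\<^sub>R (p - u) + u) $ i)"
    by simp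
  then show ?thesis by (simp add: sum_wave_index u_def axis_def algebra_simps)
qed

text \<open>The identity \<open>action_euler\<close> holds on the whole open set \<open>N\<close>,
  so it may be differentiated at \<open>p\<close>; the directions E and \<kappa> give the two
  relations that bring the entry \<open>d0\<close> of the normal form into Hessian form.\<close>

lemma action_euler_derivative:
  assumes branch: "root_branch F N am ap" and regular: "well_behaved f F N am ap" and p: "p \<in> N"
  defines "K \<equiv> action F am ap"
  shows "p$iE * partial iE (partial iE K) p + p$i\<kappa> / 2 * partial iE (partial i\<kappa> K) p
      + p$i\<omega> * partial iE (partial i\<omega> K) p + p$i\<zeta> * partial iE (partial i\<zeta> K) p
      = - partial iE K p / 2" (is ?E)
    and "p$iE * partial iE (partial i\<kappa> K) p + p$i\<kappa> / 2 * partial i\<kappa> (partial i\<kappa> K) p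
      + p$i\<omega> * partial i\<kappa> (partial i\<omega> K) p + p$i\<zeta> * partial i\<kappa> (partial i\<zeta> K) p = 0" (is ?\<kappa>)
proof -
  have C2: "C2_on N K" using regular by (auto simp: well_behaved_def K_def)
  \<comment> \<open>Twice the scaling identity with all terms on one side, hence zero on
    \<open>N\<close>.\<close>
  define P where "P p = 2 * (p$iE * partial iE K p + p$i\<omega> * partial i\<omega> K p + p$i\<zeta> * partial i\<zeta> K p)
    + p$i\<kappa> * partial i\<kappa> K p - K p" for p
  define D where "D j h = (\<Sum>i\<in>UNIV. partial i (partial j K) p * h $ i)" for j h
  have vec: "((\<lambda>p :: wave_par. p $ i) has_derivative (\<lambda>h. h $ i)) (at p)" for i
    by (simp add: bounded_linear_imp_has_derivative bounded_linear_vec_nth)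
  have dP: "(P has_derivative (\<lambda>h. 2 * (h$iE * partial iE K p + p$iE * D iE h
      + (h$i\<omega> * partial i\<omega> K p + p$i\<omega> * D i\<omega> h) + (h$i\<zeta> * partial i\<zeta> K p + p$i\<zeta> * D i\<zeta> h))
      + (h$i\<kappa> * partial i\<kappa> K p + p$i\<kappa> * D i\<kappa> h)
      - (\<Sum>i\<in>UNIV. partial i K p * h $ i))) (at p)" (is "(P has_derivative ?D) _")
    unfolding P_def D_def
    by (rule derivative_eq_intros refl C2_on_has_derivative[OF C2 p] vec)+
       (simp add: fun_eq_iff algebra_simps)
  have "(P has_derivative (\<lambda>h. 0)) (at p)"
  proof (rule has_derivative_transform_within_open[where f = "\<lambda>_. 0"])
    show "open N" using branch by (simp add: root_branch_def)
    show "0 = P q" if "q \<in> N" for q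
      using action_euler[OF branch regular that] by (simp add: P_def K_def algebra_simps)
  qed (use p in auto)
  from has_derivative_unique[OF dP this] have zero: "?D h = 0" for h
    by (rule fun_cong)
  note sym = C2_on_partial_commute[OF C2 p]
  show ?E using zero[of "axis iE 1"]
    by (simp add: D_def sum_wave_index axis_def sym[of i\<kappa> iE] sym[of i\<omega> iE] sym[of i\<zeta> iE])
  show ?\<kappa> using zero[of "axis i\<kappa> 1"]
    by (simp add: D_def sum_wave_index axis_def sym[of i\<kappa> iE] sym[of i\<omega> i\<kappa>] sym[of i\<zeta> i\<kappa>])
qed

text \<open>Raising E adds a constant to the profile function. This increases the integrand and
  pushes the two roots apart, so the action cannot decrease in E. The sign is needed to place small
  positive Floquet exponents in the range over which the spectrum is assembled.\<close>

lemma period_nonneg: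
  assumes branch: "root_branch F N am ap" and regular: "well_behaved f F N am ap" and p: "p \<in> N"
  defines "K \<equiv> action F am ap"
  shows "period K p \<ge> 0"
proof (rule ccontr)
  assume neg: "\<not> period K p \<ge> 0"
  have F: "\<forall>x>0. (F has_real_derivative f x) (at x)" and C2: "C2_on N K"
    using regular by (auto simp: well_behaved_def K_def)
  have adm: "admissible_roots F p (am p) (ap p)" if "p \<in> N" for p
    using branch that by (simp add: root_branch_def)
  have N: "open N" "continuous_on N am" "continuous_on N ap"
    using branch by (simp_all add: root_branch_def)
  define c where "c t = p + t *\<^sub>R (axis iE 1 :: wave_par)" for t
  have c0: "c 0 = p" by (simp add: c_def)
  have dc: "(c has_derivative (\<lambda>t. t *\<^sub>R axis iE 1)) (at 0)"
    unfolding c_def by (auto intro!: derivative_eq_intros)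
  have rhs: "profile_rhs F (c t) x = profile_rhs F p x + 2 * t" for t x
    by (simp add: profile_rhs_def c_def axis_def)
  have "((\<lambda>t. K (c t)) has_derivative
     (\<lambda>t. \<Sum>i\<in>UNIV. partial i K p * (t *\<^sub>R axis iE 1) $ i)) (at 0)"
    by (rule has_derivative_compose[OF dc]) (unfold c0, rule C2_on_has_derivative(1)[OF C2 p])
  then have "((\<lambda>t. K (c t)) has_real_derivative partial iE K p) (at 0)"
    by (simp add: has_field_derivative_def sum_wave_index axis_def mult_commute_abs)
  from DERIV_neg_dec_right[OF this]
  have "\<exists>d>0. \<forall>h>0. h < d \<longrightarrow> K (c (0 + h)) < K (c 0)"
    using neg by (simp add: period_def)
  then obtain d where d: "d > 0" "\<And>h. h > 0 \<Longrightarrow> h < d \<Longrightarrow> K (c h) < K p" using c0 by auto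
  have c_lim: "filterlim c (nhds p) (nhds 0)"
    using has_derivative_continuous[OF dc] c0 by (metis isCont_def tendsto_nhds_iff)
  \<comment> \<open>The midpoint keeps the branches apart: for small shifts \<open>am\<close> stays
    below it and \<open>ap\<close> above it.\<close>
  define m where "m = (am p + ap p) / 2"
  have ab: "0 < am p" "am p < m" "m < ap p" using adm[OF p] by (auto simp: admissible_roots_def m_def)
  have inN: "\<forall>\<^sub>F s in nhds 0. c s \<in> N"
    by (rule eventually_compose_filterlim[OF eventually_nhds_in_open[OF N(1) p] c_lim])
  have lim: "filterlim (\<lambda>s. b (c s)) (nhds (b p)) (nhds 0)"
    if "continuous_on N b" for b :: "wave_par \<Rightarrow> real"
    using c_lim that N(1) p
    by (metis filterlim_compose isCont_def tendsto_nhds_iff continuous_on_eq_continuous_at)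
  have "\<forall>\<^sub>F s in nhds 0. am (c s) < m" "\<forall>\<^sub>F s in nhds 0. m < ap (c s)"
    using order_tendstoD(2)[OF lim[OF N(2)] ab(2)] order_tendstoD(1)[OF lim[OF N(3)] ab(3)] by auto
  with inN have "\<forall>\<^sub>F s in nhds 0. c s \<in> N \<and> am (c s) < m \<and> m < ap (c s)"
    by eventually_elim auto
  then obtain e where e: "e > 0" "\<And>s. \<bar>s\<bar> < e \<Longrightarrow> c s \<in> N \<and> am (c s) < m \<and> m < ap (c s)"
    unfolding eventually_nhds_metric by (auto simp: dist_real_def)
  define t where "t = min d e / 2"
  have t: "t > 0" "t < d" "t < e" using d(1) e(1) by (auto simp: t_def)
  then have q: "c t \<in> N" "am (c t) < m" "m < ap (c t)" using e(2)[of t] by auto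
  note adm_t = adm[OF q(1), unfolded admissible_roots_def simple_root_def]
  note adm_0 = adm[OF p, unfolded admissible_roots_def simple_root_def]
  have nn: "profile_rhs F p x \<ge> 0" if "am p \<le> x" "x \<le> ap p" for x
    using adm_0 that by (cases "x = am p \<or> x = ap p") (auto intro: less_imp_le)
  have nn_t: "profile_rhs F (c t) x \<ge> 0" if "am (c t) \<le> x" "x \<le> ap (c t)" for x
    using adm_t that by (cases "x = am (c t) \<or> x = ap (c t)") (auto intro: less_imp_le)
  \<comment> \<open>At a root for \<open>c t\<close> the profile function of \<open>p\<close> equals
    \<open>- 2 * t < 0\<close>, so this root lies outside \<open>{am p..ap p}\<close>; the midpoint
    decides on which side.\<close>
  have "am (c t) < am p"
    using nn[of "am (c t)"] adm_t t(1) q ab rhs[of t "am (c t)"] by force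
  moreover have "ap p < ap (c t)"
    using nn[of "ap (c t)"] adm_t t(1) q ab rhs[of t "ap (c t)"] by force
  ultimately have sub: "{am p..ap p} \<subseteq> {am (c t)..ap (c t)}" by auto
  have int: "(\<lambda>x. sqrt (profile_rhs F q x)) integrable_on {l..b}" if "l > 0" for q l b
  proof (rule integrable_continuous_interval, rule continuous_on_real_sqrt)
    show "continuous_on {l..b} (profile_rhs F q)"
      using profile_rhs_differentiable[OF F] that
      by (intro continuous_at_imp_continuous_on ballI differentiable_imp_continuous_within) auto
  qed
  have pos_t: "am (c t) > 0" using adm_t by auto
  have "integral {am p..ap p} (\<lambda>x. sqrt (profile_rhs F p x))
      \<le> integral {am p..ap p} (\<lambda>x. sqrt (profile_rhs F (c t) x))"
    by (intro integral_le int[OF ab(1)]) (use t(1) in \<open>auto simp: rhs\<close>)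
  also have "\<dots> \<le> integral {am (c t)..ap (c t)} (\<lambda>x. sqrt (profile_rhs F (c t) x))"
    using int[OF ab(1)] int[OF pos_t] nn_t sub by (intro integral_subset_le) auto
  finally have "K p \<le> K (c t)" by (simp add: K_def action_def)
  then show False using d(2)[OF t(1,2)] by simp
qed

section \<open>Derivatives of the averaged action\<close>

lemma sum_whitham_index: "(\<Sum>i\<in>UNIV. g i) = g jH + g jU + g jJ + g j\<gamma> + g j\<beta> + g j\<zeta>"
proof -
  have U: "(UNIV :: whitham_index set) = {jH, jU, jJ, j\<gamma>, j\<beta>, j\<zeta>}" using whitham_index.exhaust by auto
  show ?thesis unfolding U by (simp add: add.assoc)
qed

lemma has_derivative_vec_lambda:
  fixes f :: "'a::real_normed_vector \<Rightarrow> real^'n::finite"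
  assumes "\<And>i. ((\<lambda>x. f x $ i) has_derivative (\<lambda>h. f' h $ i)) (at a)"
  shows "(f has_derivative f') (at a)"
  by (rule has_derivative_componentwise_within[THEN iffD2])
    (use assms in \<open>auto simp: Basis_vec_def inner_axis\<close>)

lemma has_derivative_vec_nth: "((\<lambda>x :: real^'n::finite. x $ i) has_derivative (\<lambda>h. h $ i)) F"
  by (simp add: bounded_linear_imp_has_derivative bounded_linear_vec_nth)

definition linear_par_deriv :: "whitham_par \<Rightarrow> whitham_par \<Rightarrow> wave_par" where
  "linear_par_deriv q h = (\<chi> i. case i of
       iE \<Rightarrow> (h$jH + (q$j\<beta> + q$jU / 2) * h$jJ + q$jJ * (h$j\<beta> + h$jU / 2)) / 4
     | i\<kappa> \<Rightarrow> h$jJ / 4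
     | i\<omega> \<Rightarrow> (q$j\<beta> + q$jU / 2) * h$jU + q$jU * h$j\<beta> - h$j\<gamma>
     | i\<zeta> \<Rightarrow> h$j\<zeta>)"

lemma has_derivative_linear_par: "(linear_par has_derivative linear_par_deriv q) (at q)"
proof (rule has_derivative_vec_lambda)
  fix i
  show "((\<lambda>q. linear_par q $ i) has_derivative (\<lambda>h. linear_par_deriv q h $ i)) (at q)"
    unfolding linear_par_def linear_par_deriv_def
    by (cases i) (auto intro!: derivative_eq_intros has_derivative_vec_nth
        simp: fun_eq_iff field_simps)
qed

text \<open>The radicand is twice \<open>profile_rhs\<close>; the \<open>sqrt 2\<close> taken out of
  the integral meets the one in front and yields the factor 2 of the action.\<close>

lemma whitham_W_eq: "whitham_W F am ap q = action F am ap (linear_par q) / pi"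
proof -
  define p where "p = linear_par q"
  have p: "p $ iE = (q$jH + q$j\<beta> * q$jJ + q$jU * q$jJ / 2) / 4" "p $ i\<kappa> = q$jJ / 4"
     "p $ i\<omega> = q$j\<beta> * q$jU + (q$jU)\<^sup>2 / 4 - q$j\<gamma>" "p $ i\<zeta> = q$j\<zeta>"
    by (simp_all add: p_def linear_par_def)
  have "q$jH + q$j\<beta> * q$jJ + q$jU * q$jJ / 2
          - 2 * R\<^sup>2 * (q$j\<beta> * q$jU + (q$jU)\<^sup>2 / 4 - q$j\<gamma>)
          - (q$jJ)\<^sup>2 / (8 * R\<^sup>2) - 2 * q$j\<zeta> * F (R\<^sup>2) = 2 * profile_rhs F p R" for R
    by (simp add: profile_rhs_def p power_divide algebra_simps)
  then have "whitham_W F am ap q = sqrt 2 / pi * integral {am p..ap p} (\<lambda>R. sqrt 2 * sqrt (profile_rhs F p R))"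
    by (simp add: whitham_W_def p_def[symmetric] real_sqrt_mult)
  then show ?thesis by (simp add: action_def p_def)
qed

lemma whitham_partials:
  fixes K :: "wave_par \<Rightarrow> real"
  assumes "C2_on N K" "linear_par q \<in> N"
  defines "W \<equiv> \<lambda>q. K (linear_par q) / pi" and "D \<equiv> \<lambda>i. partial i K (linear_par q)"
  shows "partial jH W q = D iE / (4 * pi)"
    and "partial jJ W q = ((q$j\<beta> + q$jU / 2) * D iE + D i\<kappa>) / (4 * pi)"
    and "partial jU W q = (q$jJ * D iE / 8 + (q$j\<beta> + q$jU / 2) * D i\<omega>) / pi"
    and "partial j\<gamma> W q = - D i\<omega> / pi"
    and "(W has_derivative (\<lambda>h. (\<Sum>i\<in>UNIV. D i * linear_par_deriv q h $ i) / pi)) (at q)"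
proof -
  show W: "(W has_derivative (\<lambda>h. (\<Sum>i\<in>UNIV. D i * linear_par_deriv q h $ i) / pi)) (at q)"
    unfolding W_def D_def
    using has_derivative_compose[OF has_derivative_linear_par C2_on_has_derivative(1)[OF assms(1,2)]]
    by (rule bounded_linear.has_derivative[OF bounded_linear_divide])
  show "partial jH W q = D iE / (4 * pi)"
    "partial jJ W q = ((q$j\<beta> + q$jU / 2) * D iE + D i\<kappa>) / (4 * pi)"
    "partial jU W q = (q$jJ * D iE / 8 + (q$j\<beta> + q$jU / 2) * D i\<omega>) / pi"
    "partial j\<gamma> W q = - D i\<omega> / pi"
    by (simp_all add: partial_eq[OF W] sum_wave_index linear_par_deriv_def axis_def field_simps)
qed

text \<open>The formulas of \<open>whitham_partials\<close> hold on the preimage of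
  \<open>N\<close>, an open neighbourhood of \<open>q\<close>, so they can be differentiated once
  more by the product and chain rules.\<close>

lemma whitham_partials_has_derivative:
  fixes K :: "wave_par \<Rightarrow> real"
  assumes N: "open N" and C2: "C2_on N K" and q: "linear_par q \<in> N"
  defines "W \<equiv> \<lambda>q. K (linear_par q) / pi" and "D \<equiv> \<lambda>i. partial i K (linear_par q)"
    and "s \<equiv> q$j\<beta> + q$jU / 2"
    and "D' \<equiv> \<lambda>j h. \<Sum>i\<in>UNIV. partial i (partial j K) (linear_par q) * linear_par_deriv q h $ i"
  shows "(partial jH W has_derivative (\<lambda>h. D' iE h / (4 * pi))) (at q)"
    and "(partial jJ W has_derivative
       (\<lambda>h. (s * D' iE h + D iE * (h$j\<beta> + h$jU / 2) + D' i\<kappa> h) / (4 * pi))) (at q)"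
    and "(partial jU W has_derivative (\<lambda>h. (q$jJ * D' iE h / 8 + D iE * h$jJ / 8 + s * D' i\<omega> h
       + D i\<omega> * (h$j\<beta> + h$jU / 2)) / pi)) (at q)"
    and "(partial j\<gamma> W has_derivative (\<lambda>h. - D' i\<omega> h / pi)) (at q)"
proof -
  define N' where "N' = linear_par -` N"
  have "continuous_on UNIV linear_par"
    using has_derivative_linear_par has_derivative_continuous_on[of UNIV linear_par]
    by (meson has_derivative_at_withinI)
  then have N': "open N'" "q \<in> N'" unfolding N'_def using N q by (auto simp: open_vimage)
  have dD: "((\<lambda>q. partial j K (linear_par q)) has_derivative D' j) (at q)" for j
    unfolding D'_def by (rule has_derivative_compose[OF has_derivative_linear_par C2_on_has_derivative(2)[OF C2 q]])
  note transform = has_derivative_transform_within_open[OF _ N']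
  note partials = whitham_partials[OF C2, folded W_def]
  show "(partial jH W has_derivative (\<lambda>h. D' iE h / (4 * pi))) (at q)"
    by (rule transform[where f = "\<lambda>q. partial iE K (linear_par q) / (4 * pi)"])
      (auto intro!: derivative_eq_intros dD simp: partials N'_def)
  show "(partial j\<gamma> W has_derivative (\<lambda>h. - D' i\<omega> h / pi)) (at q)"
    by (rule transform[where f = "\<lambda>q. - partial i\<omega> K (linear_par q) / pi"])
      (auto intro!: derivative_eq_intros dD simp: partials N'_def)
  show "(partial jJ W has_derivative
       (\<lambda>h. (s * D' iE h + D iE * (h$j\<beta> + h$jU / 2) + D' i\<kappa> h) / (4 * pi))) (at q)"
    by (rule transform[where f = "\<lambda>q. ((q$j\<beta> + q$jU / 2) * partial iE K (linear_par q)
            + partial i\<kappa> K (linear_par q)) / (4 * pi)"])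
      (auto intro!: derivative_eq_intros dD has_derivative_vec_nth
        simp: partials N'_def s_def D_def fun_eq_iff field_simps)
  show "(partial jU W has_derivative (\<lambda>h. (q$jJ * D' iE h / 8 + D iE * h$jJ / 8 + s * D' i\<omega> h
       + D i\<omega> * (h$j\<beta> + h$jU / 2)) / pi)) (at q)"
    by (rule transform[where f = "\<lambda>q. (q$jJ * partial iE K (linear_par q) / 8
            + (q$j\<beta> + q$jU / 2) * partial i\<omega> K (linear_par q)) / pi"])
      (auto intro!: derivative_eq_intros dD has_derivative_vec_nth
        simp: partials N'_def s_def D_def algebra_simps add_divide_distrib)
qed

text \<open>A bilinear pairing, without conjugation: the rows of the real matrices \<open>A\<close>
  and \<open>a\<close> act in this way on a complex eigenvector.\<close>

definition cdot :: "real^'n::finite \<Rightarrow> complex^'n \<Rightarrow> complex" where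
  "cdot r x = (\<Sum>i\<in>UNIV. complex_of_real (r $ i) * x $ i)"

lemma cdot_simps [simp]:
  "cdot 0 x = 0" "cdot (r + r') x = cdot r x + cdot r' x" "cdot (r - r') x = cdot r x - cdot r' x"
  "cdot (k *\<^sub>R r) x = complex_of_real k * cdot r x"
  by (simp_all add: cdot_def algebra_simps sum.distrib sum_subtractf sum_distrib_left)

lemma cdot_axis [simp]: "cdot (axis i 1) x = x $ i"
proof -
  have "cdot (axis i 1) x = (\<Sum>j\<in>UNIV. if j = i then x $ j else 0)"
    unfolding cdot_def by (rule sum.cong) (auto simp: axis_def)
  then show ?thesis by simp
qed

lemma map_matrix_of_real_mult_nth:
  "(map_matrix complex_of_real A *v x) $ r = cdot (A $ r) x"
  by (simp add: matrix_vector_mult_def cdot_def)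

text \<open>The chain rule in dual form: every gradient along \<Theta> is a combination of the
  coordinate gradients, so a vector \<open>x\<close> matters only through its values on the
  latter.\<close>

lemma cdot_whitham_grad:
  assumes \<Theta>: "\<Theta> differentiable (at v)" and D: "(\<Phi> has_derivative D) (at (\<Theta> v))"
  shows "cdot (whitham_grad \<Theta> v \<Phi>) x =
    (\<Sum>j\<in>UNIV. complex_of_real (D (axis j 1)) * cdot (whitham_grad \<Theta> v (\<lambda>q. q $ j)) x)"
proof -
  obtain \<Theta>' where \<Theta>': "(\<Theta> has_derivative \<Theta>') (at v)" using \<Theta> differentiable_def by blast
  have grad: "whitham_grad \<Theta> v \<Psi> $ i = B (\<Theta>' (axis i 1))" if "(\<Psi> has_derivative B) (at (\<Theta> v))" for \<Psi> B i
    unfolding whitham_grad_def using partial_eq[OF has_derivative_compose[OF \<Theta>' that]] by simp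
  have "D h = (\<Sum>j\<in>UNIV. D (axis j 1) * h $ j)" for h
    using fun_cong[OF has_derivative_unique[OF D has_derivative_partial[OF D]], of h]
    by (simp add: partial_eq[OF D])
  then have eq: "whitham_grad \<Theta> v \<Phi> $ i = (\<Sum>j\<in>UNIV. D (axis j 1) * whitham_grad \<Theta> v (\<lambda>q. q $ j) $ i)" for i
    unfolding grad[OF D] grad[OF has_derivative_vec_nth] .
  have "cdot (whitham_grad \<Theta> v \<Phi>) x =
    (\<Sum>i\<in>UNIV. \<Sum>j\<in>UNIV. complex_of_real (D (axis j 1)) * (complex_of_real (whitham_grad \<Theta> v (\<lambda>q. q $ j) $ i) * x $ i))"
    unfolding cdot_def eq of_real_sum of_real_mult sum_distrib_right mult.assoc ..
  also have "\<dots> = (\<Sum>j\<in>UNIV. \<Sum>i\<in>UNIV. complex_of_real (D (axis j 1)) * (complex_of_real (whitham_grad \<Theta> v (\<lambda>q. q $ j) $ i) * x $ i))"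
    by (rule sum.swap)
  finally show ?thesis unfolding cdot_def sum_distrib_left .
qed

lemma vector_4:
 "(vector [x,y,z,w] ::('a::zero)^4)$1 = x"
 "(vector [x,y,z,w] ::('a::zero)^4)$2 = y"
 "(vector [x,y,z,w] ::('a::zero)^4)$3 = z"
 "(vector [x,y,z,w] ::('a::zero)^4)$4 = w"
  unfolding vector_def by simp_all

text \<open>\<open>y\<close> is the tangent vector in the parameter space, and \<open>par_E\<close>, \<open>par_\<kappa>\<close>, \<open>par_\<omega>\<close> are the
  differentials of the linear parameters on it.\<close>

definition par_E :: "whitham_par \<Rightarrow> (whitham_index \<Rightarrow> complex) \<Rightarrow> complex" where
  "par_E q y = (y jH + of_real (q$j\<beta> + q$jU / 2) * y jJ + of_real (q$jJ) * (y j\<beta> + y jU / 2)) / 4"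

definition par_\<kappa> :: "(whitham_index \<Rightarrow> complex) \<Rightarrow> complex" where
  "par_\<kappa> y = y jJ / 4"

definition par_\<omega> :: "whitham_par \<Rightarrow> (whitham_index \<Rightarrow> complex) \<Rightarrow> complex" where
  "par_\<omega> q y = of_real (q$j\<beta> + q$jU / 2) * y jU + of_real (q$jU) * y j\<beta> - y j\<gamma>"

text \<open>The differential of \<open>partial j K\<close> on the tangent vector. There is no
  \<zeta> term because \<zeta> stays fixed in the Whitham system.\<close>

definition dK :: "(wave_par \<Rightarrow> real) \<Rightarrow> whitham_par \<Rightarrow> wave_index \<Rightarrow> (whitham_index \<Rightarrow> complex) \<Rightarrow> complex" where
  "dK K q j y = of_real (partial iE (partial j K) (linear_par q)) * par_E q y
     + of_real (partial i\<kappa> (partial j K) (linear_par q)) * par_\<kappa> y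
     + of_real (partial i\<omega> (partial j K) (linear_par q)) * par_\<omega> q y"

text \<open>Translates each gradient of \<open>W\<close> and its partials occurring in the two
  matrices, and that of the constraint, into \<open>dK\<close> and the components of the tangent
  vector \<open>y x\<close>.\<close>

lemma whitham_differentials:
  fixes K :: "wave_par \<Rightarrow> real"
  assumes N: "open N" and C2: "C2_on N K" and q: "linear_par q \<in> N"
    and \<Theta>: "\<Theta> differentiable (at v)" "\<Theta> v = q"
  defines "W \<equiv> \<lambda>q. K (linear_par q) / pi"
    and "y \<equiv> \<lambda>x j. cdot (whitham_grad \<Theta> v (\<lambda>q. q $ j)) x"
    and "D \<equiv> \<lambda>i. complex_of_real (partial i K (linear_par q))"
    and "s \<equiv> complex_of_real (q$j\<beta> + q$jU / 2)"
  assumes \<zeta>: "\<And>x. y x j\<zeta> = 0"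
  shows "4 * of_real pi * cdot (whitham_grad \<Theta> v (partial jH W)) x = dK K q iE (y x)"
    and "4 * of_real pi * cdot (whitham_grad \<Theta> v (partial jJ W)) x
       = s * dK K q iE (y x) + D iE * (y x j\<beta> + y x jU / 2) + dK K q i\<kappa> (y x)"
    and "of_real pi * cdot (whitham_grad \<Theta> v (partial jU W)) x
       = of_real (q$jJ) * dK K q iE (y x) / 8 + D iE * y x jJ / 8 + s * dK K q i\<omega> (y x)
         + D i\<omega> * (y x j\<beta> + y x jU / 2)"
    and "of_real pi * cdot (whitham_grad \<Theta> v (partial j\<gamma> W)) x = - dK K q i\<omega> (y x)"
    and "of_real pi * cdot (whitham_grad \<Theta> v W) x
       = D iE * par_E q (y x) + D i\<kappa> * par_\<kappa> (y x) + D i\<omega> * par_\<omega> q (y x)"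
proof -
  note derivs = whitham_partials_has_derivative[OF N C2 q, folded W_def]
    whitham_partials(5)[OF C2 q, folded W_def]
  have grad: "cdot (whitham_grad \<Theta> v \<Phi>) x = (\<Sum>j\<in>UNIV. complex_of_real (B (axis j 1)) * y x j)"
    if "(\<Phi> has_derivative B) (at q)" for \<Phi> B
    unfolding y_def using cdot_whitham_grad[OF \<Theta>(1)] \<Theta>(2) that by blast
  have pi: "complex_of_real pi \<noteq> 0" by simp
  note simps = sum_whitham_index sum_wave_index linear_par_deriv_def axis_def \<zeta> dK_def par_E_def
    par_\<kappa>_def par_\<omega>_def D_def s_def pi field_simps
  show "4 * of_real pi * cdot (whitham_grad \<Theta> v (partial jH W)) x = dK K q iE (y x)"
    by (simp add: grad[OF derivs(1)] simps)
  show "4 * of_real pi * cdot (whitham_grad \<Theta> v (partial jJ W)) x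
       = s * dK K q iE (y x) + D iE * (y x j\<beta> + y x jU / 2) + dK K q i\<kappa> (y x)"
    by (simp add: grad[OF derivs(2)] simps)
  show "of_real pi * cdot (whitham_grad \<Theta> v (partial jU W)) x
       = of_real (q$jJ) * dK K q iE (y x) / 8 + D iE * y x jJ / 8 + s * dK K q i\<omega> (y x)
         + D i\<omega> * (y x j\<beta> + y x jU / 2)"
    by (simp add: grad[OF derivs(3)] simps)
  show "of_real pi * cdot (whitham_grad \<Theta> v (partial j\<gamma> W)) x = - dK K q i\<omega> (y x)"
    by (simp add: grad[OF derivs(4)] simps)
  show "of_real pi * cdot (whitham_grad \<Theta> v W) x
       = D iE * par_E q (y x) + D i\<kappa> * par_\<kappa> (y x) + D i\<omega> * par_\<omega> q (y x)"
    by (simp add: grad[OF derivs(5)] simps)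
qed

section \<open>Characteristics\<close>

lemma det_map_matrix_of_real:
  "det (map_matrix complex_of_real A) = complex_of_real (det A)"
  by (simp add: det_def)

lemma det_eq_0_iff_kernel:
  fixes A :: "'a::field^'n^'n"
  shows "det A = 0 \<longleftrightarrow> (\<exists>x. x \<noteq> 0 \<and> A *v x = 0)"
  using invertible_det_nz[of A] invertible_left_inverse[of A] matrix_left_invertible_ker[of A] by auto

lemma map_matrix_of_real_mult:
  "map_matrix complex_of_real (A ** B) = map_matrix complex_of_real A ** map_matrix complex_of_real B"
  by (simp add: vec_eq_iff matrix_matrix_mult_def)

lemma map_matrix_of_real_mat_1: "map_matrix complex_of_real (mat 1) = mat 1"
  by (simp add: vec_eq_iff mat_def)

text \<open>Multiplication by \<open>A\<close> removes the inverse: eigenvectors become kernel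
  vectors of \<open>a - c A\<close>, which can be examined row by row.\<close>

lemma characteristic_iff_pencil:
  assumes "invertible A"
  shows "characteristic A a c \<longleftrightarrow> (\<exists>x. x \<noteq> 0 \<and> (\<forall>r. cdot (a $ r) x = c * cdot (A $ r) x))"
proof -
  let ?A = "map_matrix complex_of_real A" and ?a = "map_matrix complex_of_real a"
    and ?B = "map_matrix complex_of_real (matrix_inv A)"
  have inv: "?A ** ?B = mat 1" "?B ** ?A = mat 1"
    using someI_ex[OF assms[unfolded invertible_def]] unfolding map_matrix_of_real_mult[symmetric]
    by (simp_all add: matrix_inv_def map_matrix_of_real_mat_1)
  have "(map_matrix complex_of_real (matrix_inv A ** a) *v x = c *s x) \<longleftrightarrow> (?a *v x = c *s (?A *v x))" for x
  proof
    assume "map_matrix complex_of_real (matrix_inv A ** a) *v x = c *s x"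
    then have "?A *v (?B *v (?a *v x)) = ?A *v (c *s x)"
      by (simp add: map_matrix_of_real_mult matrix_vector_mul_assoc)
    then show "?a *v x = c *s (?A *v x)"
      by (simp add: matrix_vector_mul_assoc inv matrix_mul_assoc vec.scale)
  next
    assume "?a *v x = c *s (?A *v x)"
    then have "?B *v (?a *v x) = ?B *v (c *s (?A *v x))" by simp
    then show "map_matrix complex_of_real (matrix_inv A ** a) *v x = c *s x"
      by (simp add: map_matrix_of_real_mult matrix_vector_mul_assoc inv matrix_mul_assoc vec.scale)
  qed
  moreover have "(?a *v x = c *s (?A *v x)) \<longleftrightarrow> (\<forall>r. cdot (a $ r) x = c * cdot (A $ r) x)" for x
    by (simp add: vec_eq_iff map_matrix_of_real_mult_nth)
  ultimately show ?thesis by (simp add: characteristic_def)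
qed

text \<open>Together with \<open>\<zeta>\<close>, the assumptions \<open>constraint\<close>,
  \<open>inj\<close> and \<open>surj\<close> say that \<open>y\<close> maps bijectively onto the
  complex tangent vectors of the surface W_J = 0 at fixed \<zeta>; this covers either choice of
  eliminated parameter. The rows of the pencil give three equations of the symmetric system, and the
  constraint supplies the one for \<kappa>.\<close>

lemma whitham_spectrum:
  fixes K :: "wave_par \<Rightarrow> real" and m :: real and \<Theta> :: "real^4 \<Rightarrow> whitham_par"
  assumes N: "open N" and C2: "C2_on N K" and q: "linear_par q \<in> N"
    and \<Theta>: "\<Theta> differentiable (at v)" "\<Theta> v = q" and m: "m \<noteq> 0"
  defines "W \<equiv> \<lambda>q. K (linear_par q) / pi"
    and "y \<equiv> \<lambda>x j. cdot (whitham_grad \<Theta> v (\<lambda>q. q $ j)) x"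
    and "D \<equiv> \<lambda>i. complex_of_real (partial i K (linear_par q))"
    and "s \<equiv> complex_of_real (q$j\<beta> + q$jU / 2)"
    and "p \<equiv> linear_par q"
  defines "A \<equiv> whitham_A W \<Theta> v m" and "a \<equiv> whitham_a W \<Theta> v m"
    and "k \<equiv> \<lambda>i j. complex_of_real (partial i (partial j K) p)"
  assumes \<zeta>: "\<And>x. y x j\<zeta> = 0"
    and W_J: "partial jJ W q = 0" and T: "partial iE K p \<noteq> 0"
    and constraint: "\<And>x. cdot (whitham_grad \<Theta> v (partial jJ W)) x = 0"
    and inj: "\<And>x. (\<And>j. y x j = 0) \<Longrightarrow> x = 0"
    and surj: "\<And>z. z j\<zeta> = 0 \<Longrightarrow>
       s * dK K q iE z + D iE * (z j\<beta> + z jU / 2) + dK K q i\<kappa> z = 0 \<Longrightarrow> \<exists>x. \<forall>j. y x j = z j"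
    and nf_D: "nf_D K p \<noteq> 0"
  shows "invertible A"
    and "characteristic A a (\<delta> + of_real (q$jU)) \<longleftrightarrow> \<delta> \<noteq> 0 \<and>
      (\<exists>e x w u. (e \<noteq> 0 \<or> x \<noteq> 0 \<or> w \<noteq> 0 \<or> u \<noteq> 0) \<and>
        \<delta> * (k iE iE * e + k iE i\<kappa> * x) + \<delta> * k iE i\<omega> * w + D iE * u = 0 \<and>
        \<delta> * (k iE i\<kappa> * e + k i\<kappa> i\<kappa> * x) + (\<delta> * k i\<kappa> i\<omega> - D iE) * w + \<delta> * D iE / 2 * u = 0 \<and>
        \<delta> * k iE i\<omega> * e + (\<delta> * k i\<kappa> i\<omega> - D iE) * x + \<delta> * k i\<omega> i\<omega> * w = 0 \<and>
        D iE * e + \<delta> * D iE / 2 * x + (\<delta> * D i\<omega> / 2 - of_real (p$i\<kappa>) * D iE) * u = 0)"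
proof -
  have pi: "complex_of_real pi \<noteq> 0" and m': "complex_of_real m \<noteq> 0" and T': "D iE \<noteq> 0"
    using m T by (simp_all add: D_def p_def)
  define \<kappa> where "\<kappa> = complex_of_real (p$i\<kappa>)"
  have J: "complex_of_real (q$jJ) = 4 * \<kappa>" by (simp add: \<kappa>_def p_def linear_par_def)
  have y_x: "y x = (\<lambda>j. cdot (whitham_grad \<Theta> v (\<lambda>q. q $ j)) x)" for x by (simp add: y_def)
  have y_fold: "cdot (whitham_grad \<Theta> v (\<lambda>q. q $ j)) x = y x j" for x j by (simp add: y_def)
  have D_fold: "complex_of_real (partial i K (linear_par q)) = D i" for i by (simp add: D_def)
  note diffs = whitham_differentials[OF N C2 q \<Theta> \<zeta>[unfolded y_def], folded W_def s_def y_x, unfolded y_fold D_fold]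
  note W_q = whitham_partials[OF C2 q, folded W_def p_def]
  \<comment> \<open>This is the relation W_J = 0 written in terms of the action.\<close>
  have K\<kappa>: "D i\<kappa> = - s * D iE"
  proof -
    have "(q$j\<beta> + q$jU / 2) * partial iE K p + partial i\<kappa> K p = 0"
      using W_J W_q(2) by simp
    then have "partial i\<kappa> K p = - ((q$j\<beta> + q$jU / 2) * partial iE K p)" by linarith
    then show ?thesis unfolding D_def s_def p_def by (simp only: of_real_minus of_real_mult mult_minus_left)
  qed
  have W_qc: "complex_of_real (partial jH W q) = D iE / (4 * of_real pi)"
    "complex_of_real (partial jU W q) = (\<kappa> * D iE / 2 + s * D i\<omega>) / of_real pi"
    "complex_of_real (partial j\<gamma> W q) = - D i\<omega> / of_real pi"
    by (simp_all add: W_q D_def s_def p_def[symmetric] J[unfolded \<kappa>_def] \<kappa>_def)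
  have dWH: "cdot (whitham_grad \<Theta> v (partial jH W)) x = dK K q iE (y x) / (4 * of_real pi)" for x
    using diffs(1)[of x] pi by (simp add: field_simps)
  have dWU: "cdot (whitham_grad \<Theta> v (partial jU W)) x = (\<kappa> * dK K q iE (y x) / 2 + D iE * par_\<kappa> (y x) / 2
       + s * dK K q i\<omega> (y x) + D i\<omega> * (y x j\<beta> + y x jU / 2)) / of_real pi" for x
    using diffs(3)[of x] pi by (simp add: field_simps J par_\<kappa>_def)
  have dM: "cdot (whitham_grad \<Theta> v (partial j\<gamma> W)) x = - dK K q i\<omega> (y x) / of_real pi" for x
    using diffs(4)[of x] pi by (simp add: field_simps)
  have dW: "cdot (whitham_grad \<Theta> v W) x
      = (D iE * par_E q (y x) + D i\<kappa> * par_\<kappa> (y x) + D i\<omega> * par_\<omega> q (y x)) / of_real pi" for x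
    using diffs(5)[of x] pi by (simp add: field_simps)
  have con: "s * dK K q iE (y x) + D iE * (y x j\<beta> + y x jU / 2) + dK K q i\<kappa> (y x) = 0" for x
    using diffs(2)[of x] constraint[of x] by simp
  have yjJ: "y x jJ = 4 * par_\<kappa> (y x)" for x by (simp add: par_\<kappa>_def)
  have A_rows: "cdot (A $ 1) x = y x j\<beta>"
    "cdot (A $ 2) x = of_real m * (dK K q iE (y x) / (4 * of_real pi))"
    "cdot (A $ 3) x = of_real m * ((\<kappa> * dK K q iE (y x) / 2 + D iE * par_\<kappa> (y x) / 2
       + s * dK K q i\<omega> (y x) + D i\<omega> * (y x j\<beta> + y x jU / 2)) / of_real pi)"
    "cdot (A $ 4) x = of_real m * (D i\<omega> * dK K q iE (y x) - D iE * dK K q i\<omega> (y x)) / (4 * of_real pi ^ 2)" for x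
    using pi by (simp_all add: A_def whitham_A_def Let_def vector_4 \<Theta>(2) dWH dWU dM W_qc y_fold field_simps power2_eq_square)
  \<comment> \<open>Left sides of the first, third and fourth equations of the symmetric system,
    numbered by the row of the pencil that produces them.\<close>
  define R2 R4 R3 where R: "R2 \<delta> z = \<delta> * dK K q iE z + D iE * z jU"
    "R4 \<delta> z = \<delta> * dK K q i\<omega> z - D iE * par_\<kappa> z"
    "R3 \<delta> z = D iE * par_E q z + \<delta> * D iE / 2 * par_\<kappa> z + (\<delta> * D i\<omega> / 2 - \<kappa> * D iE) * z jU" for \<delta> z
  define U where "U = complex_of_real (q$jU)"
  have r1: "cdot (a $ 1) x - c * cdot (A $ 1) x = y x j\<gamma> - c * y x j\<beta>" for x c
    by (simp add: A_rows a_def whitham_a_def Let_def vector_4 y_fold)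
  have r2: "cdot (a $ 2) x - c * cdot (A $ 2) x = - (of_real m / (4 * of_real pi)) * R2 (c - U) (y x)" for x c
    using pi by (simp add: A_rows a_def whitham_a_def Let_def vector_4 \<Theta>(2) dWH W_qc y_fold U_def R field_simps)
  \<comment> \<open>After \<open>D i\<kappa>\<close> is eliminated through \<open>K\<kappa>\<close>,
    row 3 is \<open>- R3\<close> plus multiples of the residuals of the other rows.\<close>
  have r3: "cdot (a $ 3) x - c * cdot (A $ 3) x = (of_real m / of_real pi) *
     (- \<kappa> / 2 * R2 (c - U) (y x) - s * R4 (c - U) (y x) - R3 (c - U) (y x) + D i\<omega> * (y x j\<gamma> - c * y x j\<beta>))" for x c
  proof -
    have "cdot (a $ 3) x - c * cdot (A $ 3) x = of_real m / of_real pi * ((U - c) * (\<kappa> * dK K q iE (y x) / 2 + D iE * par_\<kappa> (y x) / 2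
       + s * dK K q i\<omega> (y x) + D i\<omega> * (y x j\<beta> + y x jU / 2)) + (\<kappa> * D iE / 2 + s * D i\<omega>) * y x jU
       - (D iE * par_E q (y x) + D i\<kappa> * par_\<kappa> (y x) + D i\<omega> * par_\<omega> q (y x)))"
      using pi by (simp add: A_rows a_def whitham_a_def Let_def vector_4 \<Theta>(2) dWU dW W_qc y_fold U_def[symmetric] field_simps)
    also have "par_\<omega> q (y x) = s * y x jU + U * y x j\<beta> - y x j\<gamma>" by (simp add: par_\<omega>_def s_def U_def)
    also have "(U - c) * (\<kappa> * dK K q iE (y x) / 2 + D iE * par_\<kappa> (y x) / 2
       + s * dK K q i\<omega> (y x) + D i\<omega> * (y x j\<beta> + y x jU / 2)) + (\<kappa> * D iE / 2 + s * D i\<omega>) * y x jU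
       - (D iE * par_E q (y x) + D i\<kappa> * par_\<kappa> (y x) + D i\<omega> * (s * y x jU + U * y x j\<beta> - y x j\<gamma>))
       = - \<kappa> / 2 * R2 (c - U) (y x) - s * R4 (c - U) (y x) - R3 (c - U) (y x) + D i\<omega> * (y x j\<gamma> - c * y x j\<beta>)"
      unfolding K\<kappa> R by (simp add: field_simps)
    finally show ?thesis .
  qed
  have r4: "cdot (a $ 4) x - c * cdot (A $ 4) x = (of_real m / (4 * of_real pi ^ 2)) *
     (D iE * R4 (c - U) (y x) - D i\<omega> * R2 (c - U) (y x))" for x c
    using pi by (simp add: A_rows a_def whitham_a_def Let_def vector_4 \<Theta>(2) dWH dM W_qc y_fold U_def[symmetric] R yjJ
        field_simps power2_eq_square)
  \<comment> \<open>The rows combine the residuals in a triangular way with nonzero pivots, so all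
    rows vanish exactly when all residuals do.\<close>
  have pencil: "(\<forall>r. cdot (a $ r) x = c * cdot (A $ r) x) \<longleftrightarrow>
     y x j\<gamma> = c * y x j\<beta> \<and> R2 (c - U) (y x) = 0 \<and> R4 (c - U) (y x) = 0 \<and> R3 (c - U) (y x) = 0" for x c
  proof -
    have "(\<forall>r. cdot (a $ r) x = c * cdot (A $ r) x) \<longleftrightarrow> (\<forall>r. cdot (a $ r) x - c * cdot (A $ r) x = 0)"
      by simp
    also have "\<dots> \<longleftrightarrow> y x j\<gamma> = c * y x j\<beta> \<and> R2 (c - U) (y x) = 0 \<and> R4 (c - U) (y x) = 0 \<and> R3 (c - U) (y x) = 0"
      unfolding forall_4 r1 r2 r3 r4 using pi m' T' by auto
    finally show ?thesis .
  qed
  note sym = C2_on_partial_commute[OF C2 q, folded p_def]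
  have dK: "dK K q iE z = k iE iE * par_E q z + k iE i\<kappa> * par_\<kappa> z + k iE i\<omega> * par_\<omega> q z"
    "dK K q i\<kappa> z = k iE i\<kappa> * par_E q z + k i\<kappa> i\<kappa> * par_\<kappa> z + k i\<kappa> i\<omega> * par_\<omega> q z"
    "dK K q i\<omega> z = k iE i\<omega> * par_E q z + k i\<kappa> i\<omega> * par_\<kappa> z + k i\<omega> i\<omega> * par_\<omega> q z" for z
    by (simp_all add: dK_def k_def sym[of i\<kappa> iE] sym[of i\<omega> iE] sym[of i\<omega> i\<kappa>] flip: p_def)
  \<comment> \<open>These five differentials are coordinates on the vectors with vanishing \<zeta>
    component: the components for H and \<gamma> can be recovered from them.\<close>
  have trivial: "x = 0"
    if z: "par_E q (y x) = 0" "par_\<kappa> (y x) = 0" "par_\<omega> q (y x) = 0" "y x jU = 0" "y x j\<beta> = 0" for x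
  proof (rule inj)
    fix j show "y x j = 0"
      using z \<zeta>[of x] by (cases j) (simp_all add: par_E_def par_\<kappa>_def par_\<omega>_def)
  qed
  \<comment> \<open>A complex kernel vector of \<open>A\<close>, together with the constraint,
    yields a kernel vector of the matrix behind \<open>nf_D\<close>.\<close>
  show inv: "invertible A"
  proof (rule ccontr)
    assume "\<not> invertible A"
    then have "det (map_matrix complex_of_real A) = 0"
      by (simp add: det_map_matrix_of_real invertible_det_nz)
    then obtain x where x: "x \<noteq> 0" "map_matrix complex_of_real A *v x = 0"
      by (auto simp: det_eq_0_iff_kernel)
    then have rows: "cdot (A $ r) x = 0" for r
      by (metis map_matrix_of_real_mult_nth zero_index)
    have \<beta>: "y x j\<beta> = 0" using rows[of 1] A_rows by simp
    have dE: "dK K q iE (y x) = 0" using rows[of 2] A_rows m' pi by simp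
    have d\<omega>: "dK K q i\<omega> (y x) = 0" using rows[of 4] A_rows m' pi dE T' by simp
    have "D iE * par_\<kappa> (y x) / 2 + D i\<omega> * (y x jU / 2) = 0"
      using rows[of 3] A_rows m' pi dE d\<omega> \<beta> by simp
    then have d4: "D iE * par_\<kappa> (y x) + D i\<omega> * y x jU = 0" by (simp add: field_simps)
    have d\<kappa>: "dK K q i\<kappa> (y x) + D iE * (y x jU / 2) = 0" using con[of x] dE \<beta> by (simp add: add.commute)
    define M where "M = (let K2 = (\<lambda>i j. partial i (partial j K) p); T = period K p; M = mass K p in
       (vector
       [vector [K2 i\<kappa> i\<kappa>, K2 i\<kappa> iE, K2 i\<kappa> i\<omega>, T],
        vector [K2 i\<kappa> iE, K2 iE iE, K2 iE i\<omega>, 0],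
        vector [K2 i\<kappa> i\<omega>, K2 iE i\<omega>, K2 i\<omega> i\<omega>, 0],
        vector [T, 0, 0, - M]] :: real^4^4))"
    \<comment> \<open>The order \<kappa>, E, \<omega> follows the columns of \<open>M\<close>. The
      half in the last entry accounts for the term \<open>D iE * (y x jU / 2)\<close> in
      \<open>d\<kappa>\<close> and for the factor 2 in the mass, so that the last row becomes
      \<open>d4\<close>.\<close>
    define z where "z = (vector [par_\<kappa> (y x), par_E q (y x), par_\<omega> q (y x), y x jU / 2] :: complex^4)"
    have "map_matrix complex_of_real M *v z = 0"
    proof -
      have "\<forall>r. (map_matrix complex_of_real M *v z) $ r = 0"
        using dE d\<omega> d\<kappa> d4
        unfolding forall_4 matrix_vector_mult_def z_def M_def Let_def dK
        by (simp add: sum_4 vector_4 k_def D_def period_def mass_def sym[of i\<kappa> iE] algebra_simps flip: p_def)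
      then show ?thesis by (simp add: vec_eq_iff)
    qed
    moreover have "det (map_matrix complex_of_real M) \<noteq> 0"
      using nf_D by (simp add: det_map_matrix_of_real nf_D_def M_def Let_def)
    ultimately have "z = 0" by (auto simp: det_eq_0_iff_kernel)
    then have "\<forall>r. z $ r = 0" by simp
    then have "x = 0" using trivial[of x] \<beta> unfolding forall_4 z_def vector_4 by simp
    then show False using x by simp
  qed
  show "characteristic A a (\<delta> + of_real (q$jU)) \<longleftrightarrow> \<delta> \<noteq> 0 \<and>
      (\<exists>e x w u. (e \<noteq> 0 \<or> x \<noteq> 0 \<or> w \<noteq> 0 \<or> u \<noteq> 0) \<and>
        \<delta> * (k iE iE * e + k iE i\<kappa> * x) + \<delta> * k iE i\<omega> * w + D iE * u = 0 \<and>
        \<delta> * (k iE i\<kappa> * e + k i\<kappa> i\<kappa> * x) + (\<delta> * k i\<kappa> i\<omega> - D iE) * w + \<delta> * D iE / 2 * u = 0 \<and>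
        \<delta> * k iE i\<omega> * e + (\<delta> * k i\<kappa> i\<omega> - D iE) * x + \<delta> * k i\<omega> i\<omega> * w = 0 \<and>
        D iE * e + \<delta> * D iE / 2 * x + (\<delta> * D i\<omega> / 2 - of_real (p$i\<kappa>) * D iE) * u = 0)"
    (is "_ \<longleftrightarrow> _ \<and> (\<exists>e x w u. ?nz e x w u \<and> ?eqs e x w u)")
  proof -
    define c where "c = \<delta> + U"
    have \<delta>: "c - U = \<delta>" by (simp add: c_def)
    have "characteristic A a c \<longleftrightarrow> (\<exists>x. x \<noteq> 0 \<and> (y x j\<gamma> = c * y x j\<beta> \<and>
        R2 \<delta> (y x) = 0 \<and> R4 \<delta> (y x) = 0 \<and> R3 \<delta> (y x) = 0))"
      unfolding characteristic_iff_pencil[OF inv] pencil \<delta> ..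
    also have "\<dots> \<longleftrightarrow> \<delta> \<noteq> 0 \<and> (\<exists>e x w u. ?nz e x w u \<and> ?eqs e x w u)"
    proof (intro iffI conjI; (elim exE conjE)?)
      fix x assume x: "x \<noteq> 0" and eqs: "y x j\<gamma> = c * y x j\<beta>" "R2 \<delta> (y x) = 0" "R4 \<delta> (y x) = 0" "R3 \<delta> (y x) = 0"
      \<comment> \<open>Once the \<gamma> component is \<open>c\<close> times the \<beta> component,
        \<beta> enters the \<omega> differential with coefficient \<open>- \<delta>\<close>; for
        nonzero \<delta> it can be recovered from the other unknowns.\<close>
      have w: "par_\<omega> q (y x) = s * y x jU - \<delta> * y x j\<beta>"
        unfolding par_\<omega>_def eqs(1) by (simp add: s_def c_def U_def algebra_simps)
      \<comment> \<open>At \<delta> = 0 the equations kill the differentials of U, \<kappa>, E and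
        \<omega> in turn, and then the constraint kills \<beta>. So U itself is never a
        characteristic.\<close>
      show \<delta>0: "\<delta> \<noteq> 0"
      proof
        assume "\<delta> = 0"
        then have "y x jU = 0" "par_\<kappa> (y x) = 0" using eqs T' by (simp_all add: R)
        moreover from this have "par_E q (y x) = 0" "par_\<omega> q (y x) = 0"
          using eqs(4) T' w \<open>\<delta> = 0\<close> by (simp_all add: R)
        moreover from calculation have "y x j\<beta> = 0" using con[of x] T' by (simp add: dK)
        ultimately show False using trivial x by blast
      qed
      have "?nz (par_E q (y x)) (par_\<kappa> (y x)) (par_\<omega> q (y x)) (y x jU)"
        using trivial[of x] x w \<delta>0 by auto
      moreover have "?eqs (par_E q (y x)) (par_\<kappa> (y x)) (par_\<omega> q (y x)) (y x jU)"
      proof (intro conjI)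
        \<comment> \<open>The equation for \<kappa> is \<delta> times the constraint minus
          \<open>s\<close> times \<open>R2\<close>.\<close>
        have "\<delta> * dK K q i\<kappa> (y x) - D iE * par_\<omega> q (y x) + \<delta> * D iE / 2 * y x jU
          = \<delta> * (s * dK K q iE (y x) + D iE * (y x j\<beta> + y x jU / 2) + dK K q i\<kappa> (y x)) - s * R2 \<delta> (y x)"
          unfolding w R by (simp add: algebra_simps)
        then have "\<delta> * dK K q i\<kappa> (y x) - D iE * par_\<omega> q (y x) + \<delta> * D iE / 2 * y x jU = 0"
          using con[of x] eqs(2) by simp
        then show "\<delta> * (k iE i\<kappa> * par_E q (y x) + k i\<kappa> i\<kappa> * par_\<kappa> (y x)) + (\<delta> * k i\<kappa> i\<omega> - D iE) * par_\<omega> q (y x) + \<delta> * D iE / 2 * y x jU = 0"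
          unfolding dK by (simp add: algebra_simps)
      qed (use eqs(2-4) in \<open>simp_all add: R dK \<kappa>_def algebra_simps\<close>)
      ultimately show "\<exists>e x w u. ?nz e x w u \<and> ?eqs e x w u" by blast
    next
      fix e x' w u
      assume \<delta>0: "\<delta> \<noteq> 0" and nz: "?nz e x' w u"
      assume e1: "\<delta> * (k iE iE * e + k iE i\<kappa> * x') + \<delta> * k iE i\<omega> * w + D iE * u = 0"
        and e2: "\<delta> * (k iE i\<kappa> * e + k i\<kappa> i\<kappa> * x') + (\<delta> * k i\<kappa> i\<omega> - D iE) * w + \<delta> * D iE / 2 * u = 0"
        and e3: "\<delta> * k iE i\<omega> * e + (\<delta> * k i\<kappa> i\<omega> - D iE) * x' + \<delta> * k i\<omega> i\<omega> * w = 0"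
        and e4: "D iE * e + \<delta> * D iE / 2 * x' + (\<delta> * D i\<omega> / 2 - of_real (p$i\<kappa>) * D iE) * u = 0"
      \<comment> \<open>\<open>b\<close> is the \<beta> component dictated by \<open>w\<close>. The
        \<gamma> component \<open>c * b\<close> solves the first row, and the remaining ones are
        chosen so that \<open>z\<close> has the prescribed differentials of E, \<kappa> and
        U.\<close>
      define b where "b = (s * u - w) / \<delta>"
      define z where "z j = (case j of jH \<Rightarrow> 4 * e - s * 4 * x' - 4 * \<kappa> * (b + u / 2) | jU \<Rightarrow> u
         | jJ \<Rightarrow> 4 * x' | j\<gamma> \<Rightarrow> c * b | j\<beta> \<Rightarrow> b | j\<zeta> \<Rightarrow> 0)" for j
      have b: "\<delta> * b = s * u - w" using \<delta>0 by (simp add: b_def)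
      have z: "par_E q z = e" "par_\<kappa> z = x'"
        by (simp_all add: par_E_def par_\<kappa>_def z_def J s_def)
      have z\<omega>: "par_\<omega> q z = w" using b
        by (simp add: par_\<omega>_def z_def c_def s_def U_def algebra_simps)
      have z_simps: "z jU = u" "z j\<gamma> = c * b" "z j\<beta> = b" by (simp_all add: z_def)
      \<comment> \<open>The first two equations give the constraint for \<open>z\<close> multiplied
        by \<delta>, so \<open>z\<close> is tangent and comes from some \<open>x\<close>.\<close>
      have "\<delta> * (s * dK K q iE z + D iE * (z j\<beta> + z jU / 2) + dK K q i\<kappa> z) = 0"
        unfolding dK z z\<omega> z_simps using e1 e2 b by algebra
      then have "s * dK K q iE z + D iE * (z j\<beta> + z jU / 2) + dK K q i\<kappa> z = 0" using \<delta>0 by simp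
      then obtain x where "\<forall>j. y x j = z j" using surj[of z] by (auto simp: z_def)
      then have yx: "y x = z" by auto
      have "x \<noteq> 0"
      proof
        assume "x = 0"
        then have "z j = 0" for j unfolding yx[symmetric] by (simp add: y_def cdot_def)
        then show False using nz z z\<omega> unfolding par_E_def par_\<kappa>_def par_\<omega>_def z_simps(1)[symmetric] by auto
      qed
      then show "\<exists>x. x \<noteq> 0 \<and> (y x j\<gamma> = c * y x j\<beta> \<and>
        R2 \<delta> (y x) = 0 \<and> R4 \<delta> (y x) = 0 \<and> R3 \<delta> (y x) = 0)"
        using e1 e3 e4 by (intro exI[of _ x]) (simp add: yx R dK z z\<omega> z_simps \<kappa>_def algebra_simps)
    qed
    finally show ?thesis by (simp add: c_def U_def)
  qed
qed

section \<open>Persistence of roots\<close>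

definition tail_sum :: "(nat \<times> nat \<Rightarrow> complex) \<Rightarrow> complex \<Rightarrow> real \<Rightarrow> complex" where
  "tail_sum c lam \<mu> = infsum (\<lambda>(i, j). c (i, j) * lam ^ i * complex_of_real \<mu> ^ j) {(i, j). 5 \<le> i + j}"

text \<open>Absolute summability with both variables equal to \<open>r\<close> provides a majorant
  \<open>M\<close>. Shrinking the variables to size \<rho> gains a factor
  \<open>(\<rho> / r) ^ 5\<close>, since every term has total degree at least five, and the same
  majorant serves in the Weierstrass test for holomorphy.\<close>

lemma tail_sum_bound:
  assumes r: "r > 0" and summable: "(\<lambda>(i, j). c (i, j) * of_real r ^ i * complex_of_real r ^ j)
     summable_on {(i, j). 5 \<le> i + j}"
  obtains C where "C \<ge> 0"
    and "\<And>lam \<mu> \<rho>. cmod lam \<le> \<rho> \<Longrightarrow> \<bar>\<mu>\<bar> \<le> \<rho> \<Longrightarrow> \<rho> \<le> r \<Longrightarrow> cmod (tail_sum c lam \<mu>) \<le> C * \<rho> ^ 5"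
    and "\<And>z0 d \<mu>. \<bar>\<mu>\<bar> * (cmod z0 + d) \<le> r \<Longrightarrow> \<bar>\<mu>\<bar> \<le> r \<Longrightarrow> (\<lambda>z. tail_sum c (of_real \<mu> * z) \<mu>) holomorphic_on ball z0 d"
proof -
  define S where "S = {(i, j). 5 \<le> i + (j :: nat)}"
  define M where "M = (\<lambda>(i, j). cmod (c (i, j)) * r ^ i * r ^ j)"
  have M: "M summable_on S"
  proof -
    have "(\<lambda>x. cmod (case x of (i, j) \<Rightarrow> c (i, j) * of_real r ^ i * complex_of_real r ^ j)) summable_on S"
      using summable unfolding S_def by (simp only: summable_on_iff_abs_summable_on_complex)
    moreover have "(\<lambda>x. cmod (case x of (i, j) \<Rightarrow> c (i, j) * of_real r ^ i * complex_of_real r ^ j)) = M"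
      using r by (auto simp: M_def norm_mult norm_power)
    ultimately show ?thesis by simp
  qed
  have bound: "cmod (c (i, j) * lam ^ i * of_real \<mu> ^ j) \<le> (\<rho> / r) ^ 5 * M (i, j)"
    if "cmod lam \<le> \<rho>" "\<bar>\<mu>\<bar> \<le> \<rho>" "\<rho> \<le> r" "(i, j) \<in> S" for lam \<mu> \<rho> i j
  proof -
    have \<rho>: "\<rho> \<ge> 0" using that(1) norm_ge_zero order_trans by blast
    have "cmod (c (i, j) * lam ^ i * of_real \<mu> ^ j) = cmod (c (i, j)) * (cmod lam ^ i * \<bar>\<mu>\<bar> ^ j)"
      by (simp add: norm_mult norm_power)
    also have "\<dots> \<le> cmod (c (i, j)) * (\<rho> ^ i * \<rho> ^ j)"
      using that(1,2) \<rho> by (intro mult_left_mono mult_mono power_mono) auto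
    also have "\<dots> = (\<rho> / r) ^ (i + j) * M (i, j)"
      using r by (simp add: M_def power_divide power_add)
    \<comment> \<open>Powers of \<open>\<rho> / r \<le> 1\<close> decrease, so exponent 5 is the
      worst case.\<close>
    also have "\<dots> \<le> (\<rho> / r) ^ 5 * M (i, j)"
      using that(3,4) r \<rho> by (intro mult_right_mono power_decreasing) (auto simp: S_def M_def)
    finally show ?thesis .
  qed
  define C where "C = infsum M S / r ^ 5"
  show ?thesis
  proof
    have "infsum M S \<ge> 0" using r by (intro infsum_nonneg) (auto simp: M_def)
    then show "C \<ge> 0" using r by (simp add: C_def)
  next
    fix lam \<mu> \<rho> assume *: "cmod lam \<le> \<rho>" "\<bar>\<mu>\<bar> \<le> \<rho>" "\<rho> \<le> r"
    have "cmod (tail_sum c lam \<mu>) \<le> infsum (\<lambda>x. (\<rho> / r) ^ 5 * M x) S"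
      unfolding tail_sum_def S_def[symmetric]
    proof (rule norm_infsum_le)
      show "((\<lambda>x. (\<rho> / r) ^ 5 * M x) has_sum infsum (\<lambda>x. (\<rho> / r) ^ 5 * M x) S) S"
        using M summable_on_cmult_right has_sum_infsum by blast
      have "(\<lambda>x. cmod (case x of (i, j) \<Rightarrow> c (i, j) * lam ^ i * complex_of_real \<mu> ^ j)) summable_on S"
        by (rule summable_on_comparison_test[OF summable_on_cmult_right[OF M, of "(\<rho> / r) ^ 5"]])
          (use bound[OF *] in auto)
      then have "(\<lambda>(i, j). c (i, j) * lam ^ i * complex_of_real \<mu> ^ j) summable_on S"
        by (simp only: summable_on_iff_abs_summable_on_complex)
      then show "((\<lambda>(i, j). c (i, j) * lam ^ i * complex_of_real \<mu> ^ j) has_sum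
        infsum (\<lambda>(i, j). c (i, j) * lam ^ i * complex_of_real \<mu> ^ j) S) S"
        by (rule has_sum_infsum)
    qed (use bound[OF *] in auto)
    also have "\<dots> = (\<rho> / r) ^ 5 * infsum M S"
      using M by (simp add: infsum_cmult_right)
    finally show "cmod (tail_sum c lam \<mu>) \<le> C * \<rho> ^ 5"
      by (simp add: C_def power_divide mult.commute)
  next
    fix z0 :: complex and d \<mu> :: real
    assume *: "\<bar>\<mu>\<bar> * (cmod z0 + d) \<le> r" "\<bar>\<mu>\<bar> \<le> r"
    let ?f = "\<lambda>x z. case x of (i, j) \<Rightarrow> c (i, j) * (of_real \<mu> * z) ^ i * complex_of_real \<mu> ^ j"
    \<comment> \<open>Finite partial sums are polynomials in \<open>z\<close>; dominated by
      \<open>M\<close>, they converge uniformly, so the limit is holomorphic on the ball.\<close>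
    have "uniform_limit (cball z0 d) (\<lambda>X z. \<Sum>x\<in>X. ?f x z) (\<lambda>z. \<Sum>\<^sub>\<infinity>x\<in>S. ?f x z) (finite_subsets_at_top S)"
    proof (rule Weierstrass_m_test_general)
      fix x :: "nat \<times> nat" and z assume x: "x \<in> S" and z: "z \<in> cball z0 d"
      have "cmod z \<le> cmod z0 + d" using z norm_triangle_sub[of z z0]
        by (simp add: dist_norm norm_minus_commute)
      then have "cmod (of_real \<mu> * z) \<le> r"
        using *(1) mult_left_mono[of "cmod z" "cmod z0 + d" "\<bar>\<mu>\<bar>"] by (simp add: norm_mult)
      with x show "norm (?f x z) \<le> M x"
        using bound[of "of_real \<mu> * z" r \<mu> "fst x" "snd x"] *(2) r by (cases x) auto
    qed (rule M)
    then obtain "(\<lambda>z. \<Sum>\<^sub>\<infinity>x\<in>S. ?f x z) holomorphic_on ball z0 d"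
      by (rule holomorphic_uniform_limit[rotated])
        (auto intro!: always_eventually continuous_intros holomorphic_intros simp: case_prod_unfold)
    then show "(\<lambda>z. tail_sum c (of_real \<mu> * z) \<mu>) holomorphic_on ball z0 d"
      by (simp add: tail_sum_def S_def)
  qed
qed

text \<open>In the variable \<open>z = lam / \<mu>\<close> the tail is a perturbation of order \<open>\<mu>\<close>, so by Hurwitz the
  root \<open>z0\<close> persists.\<close>

lemma perturbed_root:
  assumes r: "r > 0" and summable: "\<And>lam \<mu>. cmod lam < r \<Longrightarrow> \<bar>\<mu>\<bar> < r \<Longrightarrow>
       (\<lambda>(i, j). c (i, j) * lam ^ i * complex_of_real \<mu> ^ j) summable_on {(i, j). 5 \<le> i + j}"
    and Q: "Q \<noteq> 0" "poly Q z0 = 0" "Re z0 \<noteq> 0" and \<epsilon>: "\<epsilon> > 0"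
  obtains lam \<mu> where "0 < \<mu>" "\<mu> < \<epsilon>" "cmod lam < \<epsilon>" "Re lam \<noteq> 0"
    "of_real \<mu> ^ 4 * poly Q (lam / of_real \<mu>) + tail_sum c lam \<mu> = 0"
proof (rule ccontr)
  assume none: "\<not> thesis"
  note witness = that
  \<comment> \<open>Half the radius, because summability is given only strictly inside
    \<open>r\<close> and the majorant needs the boundary point.\<close>
  obtain C where C: "C \<ge> 0"
    "\<And>lam \<mu> \<rho>. cmod lam \<le> \<rho> \<Longrightarrow> \<bar>\<mu>\<bar> \<le> \<rho> \<Longrightarrow> \<rho> \<le> r/2 \<Longrightarrow> cmod (tail_sum c lam \<mu>) \<le> C * \<rho> ^ 5"
    "\<And>z0 d \<mu>. \<bar>\<mu>\<bar> * (cmod z0 + d) \<le> r/2 \<Longrightarrow> \<bar>\<mu>\<bar> \<le> r/2 \<Longrightarrow>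
      (\<lambda>z. tail_sum c (of_real \<mu> * z) \<mu>) holomorphic_on ball z0 d"
    by (rule tail_sum_bound[of "r/2" c]) (use r summable[of "of_real (r/2)" "r/2"] in auto)
  \<comment> \<open>The distance from \<open>z0\<close> to the imaginary axis: the open ball of this
    radius misses the axis. \<open>B\<close> bounds its points.\<close>
  define d where "d = \<bar>Re z0\<bar>"
  define B where "B = cmod z0 + d + 1"
  have d: "d > 0" using Q by (simp add: d_def)
  have B: "B \<ge> 1" using d by (simp add: B_def)
  have ball: "cmod z < B" "Re z \<noteq> 0" if "z \<in> ball z0 d" for z
  proof -
    have dist: "cmod (z - z0) < d" using that by (simp add: dist_norm norm_minus_commute)
    then show "cmod z < B" using norm_triangle_sub[of z z0] by (simp add: B_def)
    show "Re z \<noteq> 0" using abs_Re_le_cmod[of "z - z0"] dist by (auto simp: d_def)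
  qed
  \<comment> \<open>Floquet exponents tending to 0, scaled so that \<open>m n * z\<close> stays
    within \<open>r/2\<close> and below \<epsilon> for every \<open>z\<close> in the ball.\<close>
  define m where "m n = min (r/2) (\<epsilon>/2) / B / real (Suc n)" for n
  have m: "0 < m n" "m n * B \<le> r/2" "m n * B < \<epsilon>" "m n \<le> m n * B" for n
  proof -
    have m0: "0 < min (r/2) (\<epsilon>/2)" using r \<epsilon> by simp
    show "0 < m n" using B m0 unfolding m_def by (intro divide_pos_pos) auto
    then show "m n \<le> m n * B" using B by simp
    have "m n * B = min (r/2) (\<epsilon>/2) / real (Suc n)" using B by (simp add: m_def)
    also have "\<dots> \<le> min (r/2) (\<epsilon>/2)" 
      using m0 divide_left_mono[of 1 "real (Suc n)" "min (r/2) (\<epsilon>/2)"] by simp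
    finally show "m n * B \<le> r/2" "m n * B < \<epsilon>" using \<epsilon> by auto
  qed
  have m_lim: "m \<longlonglongrightarrow> 0"
    unfolding m_def by (rule real_tendsto_divide_at_top[OF tendsto_const])
      (rule filterlim_compose[OF filterlim_real_sequentially filterlim_Suc])
  \<comment> \<open>The perturbed equation at exponent \<open>m n\<close> in the variable
    \<open>z\<close>, divided by the fourth power of the exponent.\<close>
  define G where "G n z = poly Q z + tail_sum c (of_real (m n) * z) (m n) / of_real (m n) ^ 4" for n z
  \<comment> \<open>Under the contrary assumption no \<open>G n\<close> vanishes on the ball;
    Hurwitz then denies the limit its zero \<open>z0\<close>.\<close>
  have "poly Q z0 \<noteq> 0"
  proof (rule Hurwitz_no_zeros[of "ball z0 d" G "poly Q" z0])
    show "G n holomorphic_on ball z0 d" for n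
    proof -
      have "m n * (cmod z0 + d) \<le> m n * B"
        using m(1)[of n] unfolding B_def by (intro mult_left_mono) auto
      then have "\<bar>m n\<bar> * (cmod z0 + d) \<le> r/2" "\<bar>m n\<bar> \<le> r/2"
        using m[of n] by linarith+
      then have "(\<lambda>z. tail_sum c (of_real (m n) * z) (m n)) holomorphic_on ball z0 d" by (rule C(3))
      then show ?thesis unfolding G_def
        using m(1)[of n] by (intro holomorphic_intros) auto
    qed
    show "poly Q holomorphic_on ball z0 d" by (intro holomorphic_intros)
    show "\<not> poly Q constant_on ball z0 d"
    proof
      assume "poly Q constant_on ball z0 d"
      then have "ball z0 d \<subseteq> {z. poly Q z = 0}"
        using Q(2) d by (auto simp: constant_on_def)
      then have "finite (ball z0 d)" using poly_roots_finite[OF Q(1)] finite_subset by blast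
      then show False using uncountable_ball[OF d] countable_finite by blast
    qed
    show "G n z \<noteq> 0" if z: "z \<in> ball z0 d" for n z
    proof
      assume G: "G n z = 0"
      define lam where "lam = of_real (m n) * z"
      have quot: "lam / of_real (m n) = z" using m(1)[of n] by (simp add: lam_def)
      have "cmod lam = m n * cmod z" using m(1)[of n] by (simp add: lam_def norm_mult)
      also have "\<dots> \<le> m n * B" using ball(1)[OF z] m(1)[of n] by simp
      finally have "cmod lam < \<epsilon>" using m(3)[of n] by simp
      moreover have "m n < \<epsilon>" using m(3,4)[of n] by simp
      moreover have "Re lam \<noteq> 0" using ball(2)[OF z] m(1)[of n] by (simp add: lam_def)
      moreover have "of_real (m n) ^ 4 * poly Q (lam / of_real (m n)) + tail_sum c lam (m n) = 0"
      proof -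
        have "of_real (m n) ^ 4 * poly Q z + tail_sum c lam (m n) = of_real (m n) ^ 4 * G n z"
          using m(1)[of n] by (simp add: G_def lam_def distrib_left)
        then show ?thesis using G quot by simp
      qed
      ultimately show False using none witness m(1)[of n] by blast
    qed
    show "uniform_limit L G (poly Q) sequentially" if L: "L \<subseteq> ball z0 d" for L
    proof (rule uniform_limitI)
      fix e :: real assume e: "e > 0"
      have "(\<lambda>n. C * B ^ 5 * m n) \<longlonglongrightarrow> C * B ^ 5 * 0" by (intro tendsto_intros m_lim)
      then have "\<forall>\<^sub>F n in sequentially. C * B ^ 5 * m n < e"
        using e by (intro order_tendstoD) auto
      then show "\<forall>\<^sub>F n in sequentially. \<forall>z\<in>L. dist (G n z) (poly Q z) < e"
      proof eventually_elim
        case (elim n)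
        show ?case
        proof
          fix z assume "z \<in> L"
          then have z: "cmod z < B" using L ball(1) by blast
          have "cmod (tail_sum c (of_real (m n) * z) (m n)) \<le> C * (m n * B) ^ 5"
            by (rule C(2)) (use z m[of n] in \<open>auto simp: norm_mult\<close>)
          \<comment> \<open>The tail has order five and the division removes four powers, so one
            factor \<open>m n\<close> survives.\<close>
          then have "dist (G n z) (poly Q z) \<le> C * (m n * B) ^ 5 / m n ^ 4"
            using m(1)[of n] by (simp add: G_def dist_norm norm_divide norm_power divide_right_mono)
          also have "\<dots> = C * B ^ 5 * m n"
            using m(1)[of n] by (simp add: field_simps power_mult_distrib) algebra
          finally show "dist (G n z) (poly Q z) < e" using elim by simp
        qed
      qed
    qed
  qed (use d in auto)
  then show False using Q by simp
qed

section \<open>The Whitham system\<close>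

text \<open>Identifies the tangency condition in \<open>whitham_spectrum\<close> with the vanishing
  of the differential of W_J, for arbitrary \<open>z\<close> and not just for images of a given
  \<Theta>.\<close>

lemma whitham_constraint_eq:
  fixes K :: "wave_par \<Rightarrow> real" and z :: "whitham_index \<Rightarrow> complex"
  assumes "open N" "C2_on N K" "linear_par q \<in> N" and z: "z j\<zeta> = 0"
  defines "W \<equiv> \<lambda>q. K (linear_par q) / pi"
  shows "of_real (q$j\<beta> + q$jU / 2) * dK K q iE z
      + of_real (partial iE K (linear_par q)) * (z j\<beta> + z jU / 2) + dK K q i\<kappa> z
    = 4 * of_real pi * (\<Sum>j\<in>UNIV. of_real (partial j (partial jJ W) q) * z j)"
  unfolding partial_eq[OF whitham_partials_has_derivative(2)[OF assms(1-3)], folded W_def]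
  by (simp add: sum_whitham_index sum_wave_index linear_par_deriv_def axis_def z dK_def par_E_def
      par_\<kappa>_def par_\<omega>_def field_simps)

text \<open>Both cases of the Whitham system at once: the parameter \<open>l\<close>, which is \<open>H\<close> or \<open>J\<close>, is the one
  eliminated through \<open>W\<^sub>J = 0\<close>.\<close>

lemma whitham_spectrum_eliminated:
  fixes K :: "wave_par \<Rightarrow> real" and m :: real and \<Theta> :: "real^4 \<Rightarrow> whitham_par"
  assumes N: "open N" and C2: "C2_on N K" and q: "linear_par q \<in> N"
    and \<Theta>: "\<Theta> differentiable (at v)" "\<Theta> v = q" and m: "m \<noteq> 0"
  defines "W \<equiv> \<lambda>q. K (linear_par q) / pi" and "p \<equiv> linear_par q"
    and "y \<equiv> \<lambda>x j. cdot (whitham_grad \<Theta> v (\<lambda>q. q $ j)) x"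
  assumes W_J: "\<forall>\<^sub>F v' in nhds v. partial jJ W (\<Theta> v') = 0"
    and T: "partial iE K p \<noteq> 0" and D: "nf_D K p \<noteq> 0" and sigma: "nf_sigma K p \<noteq> 0"
    and euler_E: "p$iE * partial iE (partial iE K) p + p$i\<kappa> / 2 * partial iE (partial i\<kappa> K) p
      + p$i\<omega> * partial iE (partial i\<omega> K) p + p$i\<zeta> * partial iE (partial i\<zeta> K) p
      = - partial iE K p / 2"
    and euler_\<kappa>: "p$iE * partial iE (partial i\<kappa> K) p + p$i\<kappa> / 2 * partial i\<kappa> (partial i\<kappa> K) p
      + p$i\<omega> * partial i\<kappa> (partial i\<omega> K) p + p$i\<zeta> * partial i\<kappa> (partial i\<zeta> K) p = 0"
    and l: "partial l (partial jJ W) q \<noteq> 0"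
    and \<zeta>: "\<And>x. y x j\<zeta> = 0"
    and surj: "\<And>z. \<exists>x. \<forall>j. j \<noteq> l \<longrightarrow> j \<noteq> j\<zeta> \<longrightarrow> y x j = z j"
    and inj: "\<And>x. (\<And>j. j \<noteq> l \<Longrightarrow> y x j = 0) \<Longrightarrow> x = 0"
  shows "invertible (whitham_A W \<Theta> v m)"
    and "\<mu> \<noteq> 0 \<Longrightarrow> normal_form K p lam \<mu> = 0 \<longleftrightarrow>
      characteristic (whitham_A W \<Theta> v m) (whitham_a W \<Theta> v m) (\<i> * lam / of_real \<mu> + of_real (q$jU))"
proof -
  \<comment> \<open>W_J vanishes identically along \<Theta> near \<open>v\<close>, hence so does its
    gradient there.\<close>
  have constraint: "cdot (whitham_grad \<Theta> v (partial jJ W)) x = 0" for x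
  proof -
    obtain S where S: "open S" "v \<in> S" "\<And>v. v \<in> S \<Longrightarrow> 0 = partial jJ W (\<Theta> v)"
      using W_J unfolding eventually_nhds by metis
    have "((\<lambda>v. partial jJ W (\<Theta> v)) has_derivative (\<lambda>h. 0)) (at v)"
      by (rule has_derivative_transform_within_open[OF _ S]) auto
    from partial_eq[OF this] have "whitham_grad \<Theta> v (partial jJ W) = 0"
      by (simp add: whitham_grad_def vec_eq_iff)
    then show ?thesis by simp
  qed
  note con_eq = whitham_constraint_eq[OF N C2 q, folded W_def]
  have con: "(\<Sum>j\<in>UNIV. of_real (partial j (partial jJ W) q) * y x j) = 0" for x
    using whitham_differentials(2)[OF N C2 q \<Theta>, folded W_def, of x] constraint[of x]
      con_eq[of "y x"] \<zeta> by (simp add: y_def)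
  \<comment> \<open>All components except \<open>l\<close> and \<zeta> are free, and \<zeta>
    vanishes on both sides; the linearised constraint then fixes the component \<open>l\<close>,
    whose coefficient is nonzero.\<close>
  have surj': "\<exists>x. \<forall>j. y x j = z j"
    if z: "z j\<zeta> = 0" "of_real (q$j\<beta> + q$jU / 2) * dK K q iE z
      + of_real (partial iE K (linear_par q)) * (z j\<beta> + z jU / 2) + dK K q i\<kappa> z = 0" for z
  proof -
    obtain x where x: "\<And>j. j \<noteq> l \<Longrightarrow> y x j = z j" using surj[of z] \<zeta> z(1) by metis
    have "(\<Sum>j\<in>UNIV. of_real (partial j (partial jJ W) q) * (y x j - z j)) = 0"
      using con[of x] con_eq[of z] z by (simp add: right_diff_distrib sum_subtractf)
    moreover have "(\<Sum>j\<in>UNIV. of_real (partial j (partial jJ W) q) * (y x j - z j))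
      = (\<Sum>j\<in>{l}. of_real (partial j (partial jJ W) q) * (y x j - z j))"
      by (rule sum.mono_neutral_right) (use x in auto)
    ultimately have "y x l = z l" using l(1) by simp
    with x show ?thesis by metis
  qed
  have W_Jq: "partial jJ W q = 0" using eventually_nhds_x_imp_x[OF W_J] \<Theta>(2) by simp
  note spectrum = whitham_spectrum[OF N C2 q \<Theta> m, folded W_def p_def,
      OF \<zeta>[unfolded y_def] W_Jq T constraint inj[unfolded y_def] surj'[unfolded y_def p_def[symmetric]] D]
  show "invertible (whitham_A W \<Theta> v m)" by (rule spectrum(1))
  assume \<mu>: "\<mu> \<noteq> 0"
  have pN: "p \<in> N" using q by (simp add: p_def)
  note nf = normal_form_zero_iff[OF C2 pN euler_E euler_\<kappa> sigma]
  define \<delta> where "\<delta> = \<i> * lam / of_real \<mu>"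
  have lam: "lam = - \<i> * of_real \<mu> * \<delta>" using \<mu> by (simp add: \<delta>_def)
  show "normal_form K p lam \<mu> = 0 \<longleftrightarrow>
      characteristic (whitham_A W \<Theta> v m) (whitham_a W \<Theta> v m) (\<i> * lam / of_real \<mu> + of_real (q$jU))"
  proof (cases "\<delta> = 0")
    \<comment> \<open>Both sides are false: \<open>lam = 0\<close> is no root of the normal form,
      and U is no characteristic.\<close>
    case True
    then have "normal_form K p lam \<mu> \<noteq> 0" using nf(1) \<mu> T lam by simp
    then show ?thesis using spectrum(2)[of \<delta>] True by (simp flip: \<delta>_def)
  next
    case False
    have "characteristic (whitham_A W \<Theta> v m) (whitham_a W \<Theta> v m) (\<delta> + of_real (q$jU)) \<longleftrightarrow>
        normal_form K p lam \<mu> = 0"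
      using spectrum(2)[of \<delta>] nf(2)[OF False \<mu>, folded lam] False by (simp only: simp_thms)
    then show ?thesis by (simp flip: \<delta>_def)
  qed
qed

text \<open>In either case four coordinates of \<Theta> are the entries of \<open>v\<close>, with
  unit vectors as gradients, and \<zeta> is constant; this gives the assumptions of
  \<open>whitham_spectrum_eliminated\<close>. The multiplier of the rows is also the coefficient of
  the eliminated parameter in the linearised constraint.\<close>

lemma whitham_system_spectrum:
  fixes K :: "wave_par \<Rightarrow> real"
  assumes N: "open N" and C2: "C2_on N K" and q: "linear_par q \<in> N"
  defines "W \<equiv> \<lambda>q. K (linear_par q) / pi" and "p \<equiv> linear_par q"
  assumes system: "whitham_system W q A a"
    and T: "partial iE K p \<noteq> 0" and D: "nf_D K p \<noteq> 0" and sigma: "nf_sigma K p \<noteq> 0"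
    and euler_E: "p$iE * partial iE (partial iE K) p + p$i\<kappa> / 2 * partial iE (partial i\<kappa> K) p
      + p$i\<omega> * partial iE (partial i\<omega> K) p + p$i\<zeta> * partial iE (partial i\<zeta> K) p
      = - partial iE K p / 2"
    and euler_\<kappa>: "p$iE * partial iE (partial i\<kappa> K) p + p$i\<kappa> / 2 * partial i\<kappa> (partial i\<kappa> K) p
      + p$i\<omega> * partial i\<kappa> (partial i\<omega> K) p + p$i\<zeta> * partial i\<kappa> (partial i\<zeta> K) p = 0"
  shows "invertible A \<and> (\<forall>\<mu> lam. \<mu> \<noteq> 0 \<longrightarrow> (normal_form K p lam \<mu> = 0 \<longleftrightarrow>
      characteristic A a (\<i> * lam / of_real \<mu> + of_real (q$jU))))"
proof -
  note spectrum = whitham_spectrum_eliminated[OF N C2 q, folded W_def p_def]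
  note rest = T D sigma euler_E euler_\<kappa>
  have grad: "whitham_grad \<Theta> v (\<lambda>q. q $ j) = axis i 1" if "\<And>v. \<Theta> v $ j = v $ i" for \<Theta> v j i
    by (simp add: whitham_grad_def that partial_eq[OF has_derivative_vec_nth] vec_eq_iff axis_def eq_commute)
  have grad0: "whitham_grad \<Theta> v (\<lambda>q. q $ j) = 0" if "\<And>v. \<Theta> v $ j = c" for \<Theta> v j c
    by (simp add: whitham_grad_def that partial_eq[OF has_derivative_const] vec_eq_iff)
  note comp = subst_H_def subst_J_def whitham_point_def
  from system consider
    (H) g v \<Theta> where "partial jH (partial jJ W) q \<noteq> 0" "\<Theta> = subst_H (q$j\<zeta>) g" "solves_WJ W \<Theta> g v q"
      "A = whitham_A W \<Theta> v (partial jH (partial jJ W) q)" "a = whitham_a W \<Theta> v (partial jH (partial jJ W) q)"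
  | (J) h v \<Theta> where "partial jJ (partial jJ W) q \<noteq> 0" "\<Theta> = subst_J (q$j\<zeta>) h" "solves_WJ W \<Theta> h v q"
      "A = whitham_A W \<Theta> v (partial jJ (partial jJ W) q)" "a = whitham_a W \<Theta> v (partial jJ (partial jJ W) q)"
    unfolding whitham_system_def Let_def by blast
  then show ?thesis
  proof cases
    case H
    note solves = H(3)[unfolded solves_WJ_def]
    have "\<Theta> differentiable (at v)"
    proof -
      obtain g' where g': "(g has_derivative g') (at v)" using solves differentiable_def by blast
      have "(\<Theta> has_derivative (\<lambda>h. whitham_point (g' h) (h$3) (h$1) (h$2) (h$4) 0)) (at v)"
      proof (rule has_derivative_vec_lambda)
        fix i show "((\<lambda>v. \<Theta> v $ i) has_derivative
            (\<lambda>h. whitham_point (g' h) (h$3) (h$1) (h$2) (h$4) 0 $ i)) (at v)"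
          by (cases i) (simp_all add: H(2) comp g' has_derivative_vec_nth)
      qed
      then show ?thesis using differentiable_def by blast
    qed
    moreover have grads: "whitham_grad \<Theta> v (\<lambda>q. q $ jJ) = axis 1 1" "whitham_grad \<Theta> v (\<lambda>q. q $ j\<gamma>) = axis 2 1"
      "whitham_grad \<Theta> v (\<lambda>q. q $ jU) = axis 3 1" "whitham_grad \<Theta> v (\<lambda>q. q $ j\<beta>) = axis 4 1"
      "whitham_grad \<Theta> v (\<lambda>q. q $ j\<zeta>) = 0"
      by (rule grad grad0, simp add: H(2) comp)+
    moreover have "\<exists>x. \<forall>j. j \<noteq> jH \<longrightarrow> j \<noteq> j\<zeta> \<longrightarrow> cdot (whitham_grad \<Theta> v (\<lambda>q. q $ j)) x = z j" for z
    proof (intro exI[of _ "vector [z jJ, z j\<gamma>, z jU, z j\<beta>]"] allI impI)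
      fix j assume "j \<noteq> jH" "j \<noteq> j\<zeta>"
      then show "cdot (whitham_grad \<Theta> v (\<lambda>q. q $ j)) (vector [z jJ, z j\<gamma>, z jU, z j\<beta>]) = z j"
        by (cases j) (simp_all add: grads vector_4)
    qed
    moreover have "x = 0" if "\<And>j. j \<noteq> jH \<Longrightarrow> cdot (whitham_grad \<Theta> v (\<lambda>q. q $ j)) x = 0" for x
      using that[of jJ] that[of j\<gamma>] that[of jU] that[of j\<beta>] by (simp add: grads vec_eq_iff forall_4)
    ultimately show ?thesis
      using spectrum[of \<Theta> v "partial jH (partial jJ W) q" jH] rest H(1,4,5) solves by simp
  next
    case J
    note solves = J(3)[unfolded solves_WJ_def]
    have "\<Theta> differentiable (at v)"
    proof -
      obtain h' where h': "(h has_derivative h') (at v)" using solves differentiable_def by blast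
      have "(\<Theta> has_derivative (\<lambda>t. whitham_point (t$1) (t$3) (h' t) (t$2) (t$4) 0)) (at v)"
      proof (rule has_derivative_vec_lambda)
        fix i show "((\<lambda>v. \<Theta> v $ i) has_derivative
            (\<lambda>t. whitham_point (t$1) (t$3) (h' t) (t$2) (t$4) 0 $ i)) (at v)"
          by (cases i) (simp_all add: J(2) comp h' has_derivative_vec_nth)
      qed
      then show ?thesis using differentiable_def by blast
    qed
    moreover have grads: "whitham_grad \<Theta> v (\<lambda>q. q $ jH) = axis 1 1" "whitham_grad \<Theta> v (\<lambda>q. q $ j\<gamma>) = axis 2 1"
      "whitham_grad \<Theta> v (\<lambda>q. q $ jU) = axis 3 1" "whitham_grad \<Theta> v (\<lambda>q. q $ j\<beta>) = axis 4 1"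
      "whitham_grad \<Theta> v (\<lambda>q. q $ j\<zeta>) = 0"
      by (rule grad grad0, simp add: J(2) comp)+
    moreover have "\<exists>x. \<forall>j. j \<noteq> jJ \<longrightarrow> j \<noteq> j\<zeta> \<longrightarrow> cdot (whitham_grad \<Theta> v (\<lambda>q. q $ j)) x = z j" for z
    proof (intro exI[of _ "vector [z jH, z j\<gamma>, z jU, z j\<beta>]"] allI impI)
      fix j assume "j \<noteq> jJ" "j \<noteq> j\<zeta>"
      then show "cdot (whitham_grad \<Theta> v (\<lambda>q. q $ j)) (vector [z jH, z j\<gamma>, z jU, z j\<beta>]) = z j"
        by (cases j) (simp_all add: grads vector_4)
    qed
    moreover have "x = 0" if "\<And>j. j \<noteq> jJ \<Longrightarrow> cdot (whitham_grad \<Theta> v (\<lambda>q. q $ j)) x = 0" for x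
      using that[of jH] that[of j\<gamma>] that[of jU] that[of j\<beta>] by (simp add: grads vec_eq_iff forall_4)
    ultimately show ?thesis
      using spectrum[of \<Theta> v "partial jJ (partial jJ W) q" jJ] rest J(1,4,5) solves by simp
  qed
qed

section \<open>Instability from roots of the normal form off the imaginary axis\<close>

lemma normal_form_poly:
  obtains Q where "\<And>lam \<mu>. \<mu> \<noteq> 0 \<Longrightarrow> normal_form K p lam \<mu> = of_real \<mu> ^ 4 * poly Q (lam / of_real \<mu>)"
proof -
  \<comment> \<open>Each matrix entry is a quadratic form in \<open>lam\<close> and \<mu>, so the
    determinant is homogeneous of degree four and depends, after scaling, only on the ratio.\<close>
  define P where "P a2 a1 a0 = (\<lambda>l m. l\<^sup>2 * a2 + l * m * a1 + m\<^sup>2 * a0)" for a2 a1 a0 :: complex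
  have P: "P a2 a1 a0 l m = m\<^sup>2 * poly [:a0, a1, a2:] (l / m)" if "m \<noteq> 0" for a2 a1 a0 l m
    using that by (simp add: P_def field_simps power2_eq_square)
  have "\<exists>a2 a1 a0 b2 b1 b0 d2 d1 d0. \<forall>lam \<mu>. normal_form K p lam \<mu>
     = P a2 a1 a0 lam (of_real \<mu>) * P d2 d1 d0 lam (of_real \<mu>)
     - P b2 b1 b0 lam (of_real \<mu>) * P b2 b1 b0 lam (of_real \<mu>)"
    unfolding normal_form_def Let_def det_2 P_def
    by (simp only: vec_lambda_beta vector_2) (intro exI allI, rule refl)
  then obtain a2 a1 a0 b2 b1 b0 d2 d1 d0 where nf: "\<And>lam \<mu>. normal_form K p lam \<mu>
     = P a2 a1 a0 lam (of_real \<mu>) * P d2 d1 d0 lam (of_real \<mu>)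
     - P b2 b1 b0 lam (of_real \<mu>) * P b2 b1 b0 lam (of_real \<mu>)" by blast
  show thesis
  proof (rule that[of "[:a0, a1, a2:] * [:d0, d1, d2:] - [:b0, b1, b2:] * [:b0, b1, b2:]"])
    fix lam and \<mu> :: real assume "\<mu> \<noteq> 0"
    then have "complex_of_real \<mu> \<noteq> 0" by simp
    note P_\<mu> = P[OF this]
    show "normal_form K p lam \<mu> = of_real \<mu> ^ 4 *
        poly ([:a0, a1, a2:] * [:d0, d1, d2:] - [:b0, b1, b2:] * [:b0, b1, b2:]) (lam / of_real \<mu>)"
      unfolding nf P_\<mu> poly_diff poly_mult by algebra
  qed
qed

text \<open>A root at \<mu> = 1 is a root of a polynomial in \<open>lam / \<mu>\<close>, and
  \<open>perturbed_root\<close> turns it into points of the spectrum near the origin. Nonvanishing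
  at 0 ensures that this polynomial is not identically zero, even if its leading coefficient
  vanishes.\<close>

lemma normal_form_root_imp_unstable:
  assumes linear: "linear_theory f K p \<phi>" and T: "period K p > 0"
    and root: "normal_form K p z0 1 = 0" "Re z0 \<noteq> 0" and nz: "normal_form K p 0 1 \<noteq> 0"
  shows "modulationally_unstable f p \<phi> (period K p)"
  unfolding modulationally_unstable_def
proof (intro allI impI)
  fix \<epsilon> :: real assume \<epsilon>: "\<epsilon> > 0"
  obtain Q where Q: "\<And>lam \<mu>. \<mu> \<noteq> 0 \<Longrightarrow> normal_form K p lam \<mu> = of_real \<mu> ^ 4 * poly Q (lam / of_real \<mu>)"
    by (rule normal_form_poly[of K p]) blast
  obtain c r where r: "r > 0"
    and summable: "\<And>lam \<mu>. cmod lam < r \<Longrightarrow> \<bar>\<mu>\<bar> < r \<Longrightarrow>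
       (\<lambda>(i, j). c (i, j) * lam ^ i * complex_of_real \<mu> ^ j) summable_on {(i, j). 5 \<le> i + j}"
    and spectrum: "\<And>lam \<mu>. cmod lam < r \<Longrightarrow> \<bar>\<mu>\<bar> < r \<Longrightarrow>
       lam \<in> floquet_spectrum f p \<phi> (period K p) \<mu> \<longleftrightarrow> normal_form K p lam \<mu> + tail_sum c lam \<mu> = 0"
    using linear unfolding linear_theory_def Let_def tail_sum_def by blast
  \<comment> \<open>The three bounds put \<open>lam\<close> within \<epsilon>, both variables within
    the radius \<open>r\<close>, and \<mu> within the range of Floquet exponents.\<close>
  define e where "e = min \<epsilon> (min r (pi / period K p))"
  have e: "e > 0" "e \<le> \<epsilon>" "e \<le> r" "e \<le> pi / period K p" using \<epsilon> r T by (auto simp: e_def)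
  have "Q \<noteq> 0" "poly Q z0 = 0" using Q[of 1] root nz by auto
  then obtain lam \<mu> where lam: "0 < \<mu>" "\<mu> < e" "cmod lam < e" "Re lam \<noteq> 0"
    "of_real \<mu> ^ 4 * poly Q (lam / of_real \<mu>) + tail_sum c lam \<mu> = 0"
    using perturbed_root[OF r summable _ _ root(2) e(1)] by blast
  then have "lam \<in> floquet_spectrum f p \<phi> (period K p) \<mu>"
    using spectrum[of lam \<mu>] Q[of \<mu> lam] e by simp
  moreover have "\<mu> \<in> {- pi / period K p<..pi / period K p}"
    using lam(1,2) e(4) T by (auto intro: less_trans[of _ 0])
  ultimately have "lam \<in> lin_spectrum f p \<phi> (period K p)" unfolding lin_spectrum_def by blast
  then show "\<exists>lam\<in>lin_spectrum f p \<phi> (period K p). cmod lam < \<epsilon> \<and> Re lam \<noteq> 0"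
    using lam(3,4) e(2) by force
qed

theorem corollary2:
  fixes f F :: "real \<Rightarrow> real"
    and N :: "wave_par set"
    and am ap :: "wave_par \<Rightarrow> real"
    and H U J \<gamma> \<beta> \<zeta> :: real
    and q :: whitham_par and p :: wave_par
    and K :: "wave_par \<Rightarrow> real" and W :: "whitham_par \<Rightarrow> real"
    and \<phi> :: "real \<Rightarrow> real"
    and A a :: "real^4^4"
  assumes q: "q = whitham_point H U J \<gamma> \<beta> \<zeta>"
    and p: "p = linear_par q"
    and K: "K = action F am ap"
    and W: "W = whitham_W F am ap"
    and branch: "root_branch F N am ap"
    and regular: "well_behaved f F N am ap"
    and p_in: "p \<in> N"
    and W_J: "partial jJ W q = 0"
    and F_indep: "indep_one_id_inverse F"
    and profile: "wave_profile F p (am p) (ap p) (period K p) \<phi>"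
    and nonconstant: "\<not> (\<exists>c. \<forall>y. \<phi> y = c)"
    and sigma: "nf_sigma K p \<noteq> 0"
    and D: "nf_D K p \<noteq> 0"
    and T_nonzero: "period K p \<noteq> 0"
    and system: "whitham_system W q A a"
  shows "invertible A \<and>
    (\<forall>\<mu>::real. \<mu> \<noteq> 0 \<longrightarrow>
       ((\<exists>c. characteristic A a c \<and> c \<notin> \<real>) \<longleftrightarrow>
        (\<exists>lam. normal_form K p lam \<mu> = 0 \<and> Re lam \<noteq> 0))) \<and>
    (\<forall>\<mu>::real. \<mu> \<noteq> 0 \<longrightarrow>
       (\<forall>lam. normal_form K p lam \<mu> = 0 \<longleftrightarrow>
          characteristic A a (\<i> * lam / complex_of_real \<mu> + complex_of_real U))) \<and>
    (linear_theory f K p \<phi> \<longrightarrow> (\<exists>c. characteristic A a c \<and> c \<notin> \<real>) \<longrightarrow>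
       modulationally_unstable f p \<phi> (period K p))"
proof -
  have C2: "C2_on N K" and N: "open N"
    using regular branch by (simp_all add: well_behaved_def root_branch_def K)
  have W': "W = (\<lambda>q. K (linear_par q) / pi)" by (simp add: W K whitham_W_eq fun_eq_iff)
  have T0: "partial iE K p \<noteq> 0" using T_nonzero by (simp add: period_def)
  have T: "period K p > 0"
    using period_nonneg[OF branch regular p_in] T_nonzero by (simp add: K)
  have U: "q $ jU = U" by (simp add: q whitham_point_def)
  note euler = action_euler_derivative[OF branch regular p_in, folded K]
  have spectrum: "invertible A \<and> (\<forall>\<mu> lam. \<mu> \<noteq> 0 \<longrightarrow> (normal_form K p lam \<mu> = 0 \<longleftrightarrow>
      characteristic A a (\<i> * lam / of_real \<mu> + of_real U)))"
    using whitham_system_spectrum[OF N C2 p_in[unfolded p] system[unfolded W'], folded p, OF T0 D sigma euler]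
    unfolding U .
  have criterion: "(\<exists>c. characteristic A a c \<and> c \<notin> \<real>) \<longleftrightarrow>
      (\<exists>lam. normal_form K p lam \<mu> = 0 \<and> Re lam \<noteq> 0)" if \<mu>: "\<mu> \<noteq> 0" for \<mu>
  proof
    assume "\<exists>c. characteristic A a c \<and> c \<notin> \<real>"
    then obtain c where c: "characteristic A a c" "c \<notin> \<real>" by blast
    \<comment> \<open>The correspondence solved for \<open>lam\<close>. The factor
      \<open>\<i>\<close> exchanges real and imaginary parts, so non-real characteristics match
      roots off the imaginary axis.\<close>
    define lam where "lam = - \<i> * of_real \<mu> * (c - of_real U)"
    have "\<i> * lam / of_real \<mu> + of_real U = c" using \<mu> by (simp add: lam_def)
    then have "normal_form K p lam \<mu> = 0" using spectrum \<mu> c(1) by simp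
    moreover have "Re lam = \<mu> * Im c" by (simp add: lam_def)
    then have "Re lam \<noteq> 0" using \<mu> c(2) by (simp add: complex_is_Real_iff)
    ultimately show "\<exists>lam. normal_form K p lam \<mu> = 0 \<and> Re lam \<noteq> 0" by blast
  next
    assume "\<exists>lam. normal_form K p lam \<mu> = 0 \<and> Re lam \<noteq> 0"
    then obtain lam where lam: "normal_form K p lam \<mu> = 0" "Re lam \<noteq> 0" by blast
    define c where "c = \<i> * lam / of_real \<mu> + of_real U"
    have "characteristic A a c" using spectrum \<mu> lam(1) by (simp add: c_def)
    moreover have "Im c = Re lam / \<mu>" by (simp add: c_def)
    then have "c \<notin> \<real>" using \<mu> lam(2) by (simp add: complex_is_Real_iff)
    ultimately show "\<exists>c. characteristic A a c \<and> c \<notin> \<real>" by blast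
  qed
  have "modulationally_unstable f p \<phi> (period K p)"
    if linear: "linear_theory f K p \<phi>" and c: "\<exists>c. characteristic A a c \<and> c \<notin> \<real>"
  proof -
    \<comment> \<open>By homogeneity \<mu> = 1 suffices: its roots are the ratios of
      \<open>lam\<close> to \<mu>.\<close>
    obtain z0 where "normal_form K p z0 1 = 0" "Re z0 \<noteq> 0" using criterion[of 1] c by auto
    moreover have "normal_form K p 0 1 \<noteq> 0"
      using normal_form_at_0[OF C2 p_in euler sigma] T0 by simp
    ultimately show ?thesis using normal_form_root_imp_unstable[OF linear T] by blast
  qed
  then show ?thesis using spectrum criterion by blast
qed

end
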